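(* Let $X$ be a Banach space, $n$ a positive integer and $1<p<\infty$. The Rademacher maximal operator (for $X$-valued functions) is $L^p$ bounded on $\mathbb{R}^n$ if and only if it is $L^p$ bounded on $\mathbb{R}$, and also if and only if it is $L^p$ bounded on $[0,1)$. Explicitly, for any dyadic system $\mathscr{D}^\beta$ on $\mathbb{R}^n$ and any dyadic system $\mathscr{D}^{\beta'}$ on $\mathbb{R}$, the following are equivalent: (a) there is a constant $C$ such that $\|\mathscr{M}_{\mathscr{D}^\beta}f\|_{L^p(\mathbb{R}^n)}\le C\|f\|_{L^p(\mathbb{R}^n;X)}$ for all $f\in L^p(\mathbb{R}^n;X)$; (b) there is a constant $C$ such that $\|\mathscr{M}_{\mathscr{D}^{\beta'}}f\|_{L^p(\mathbb{R})}\le C\|f\|_{L^p(\mathbb{R};X)}$ for all $f\in L^p(\mathbb{R};X)$; (c) there is a constant $C$ such that $\|\mathscr{M}_{[0,1)}f\|_{L^p([0,1))}\le C\|f\|_{L^p([0,1);X)}$ for all $f\in L^p([0,1);X)$.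
   Context: The dyadic systems on $\mathbb{R}^d$ ($d\ge1$) are expressed through a parameter $\beta=(\beta_j)_{j\in\mathbb{Z}}\in(\{0,1\}^d)^{\mathbb{Z}}$: $\mathscr{D}^\beta=\bigcup_{k\in\mathbb{Z}}\mathscr{D}^\beta_k$ with $\mathscr{D}^\beta_k=\{2^{-k}([0,1)^d+m)+\sum_{j>k}2^{-j}\beta_j: m\in\mathbb{Z}^d\}$. The standard system is $\beta=0$. R-bound: let $(\varepsilon_k)$ be independent random variables taking values $+1$ and $-1$, each with probability $1/2$, and let $\mathbb{E}$ denote expectation. For $S\subset X$, the R-bound $\mathscr{R}(S)\in[0,\infty]$ is the smallest $C$ such that $\big(\mathbb{E}\|\sum_k\varepsilon_k\lambda_k\xi_k\|^2\big)^{1/2}\le C\big(\sum_k|\lambda_k|^2\big)^{1/2}$ for all finite families of vectors $\xi_k\in S$ and scalars $\lambda_k$ ($\mathscr{R}(S)=\infty$ if no such $C$ exists). For a dyadic system $\mathscr{D}$ on $\mathbb{R}^d$ and a locally Bochner integrable $f:\mathbb{R}^d\to X$, $\mathscr{M}_{\mathscr{D}}f(x)=\mathscr{R}(\langle f\rangle_Q: Q\in\mathscr{D},\,Q\ni x)$, where $\langle f\rangle_Q=\frac{1}{|Q|}\int_Q f(y)\,dy$. For integrable $f:[0,1)\to X$, $\mathscr{M}_{[0,1)}f(x)=\mathscr{R}(\langle f\rangle_I: I\ni x)$, $x\in[0,1)$, where $I$ ranges over the standard dyadic intervals $I=2^{-k}([0,1)+m)$ ($k\ge 0$, $m\in\mathbb{Z}$)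 contained in $[0,1)$. *)

theory Defs
  imports "HOL-Probability.Probability"
begin

text \<open>
  The scalar field \<open>'k\<close> enters the R-bound, so it is kept as a parameter. A
  \<^class>\<open>real_normed_field\<close> is a real normed division algebra with multiplicative norm, hence (up to
  isomorphism) \<open>\<real>\<close> or \<open>\<complex>\<close>; the locale thus describes exactly the real and the complex
  Banach spaces.
\<close>

locale banach_over = vector_space smul
  for smul :: "'k::real_normed_field \<Rightarrow> 'x::banach \<Rightarrow> 'x" +
  assumes norm_scale: "norm (smul a x) = norm a * norm x"
    and scale_of_real: "smul (of_real r) x = r *\<^sub>R x"

lemma banach_over_scaleR: "banach_over (scaleR :: real \<Rightarrow> 'x::banach \<Rightarrow> 'x)"
  by unfold_locales (simp_all add: algebra_simps)

lemma banach_over_mult: "banach_over ((*) :: 'k::{real_normed_field,banach} \<Rightarrow> 'k \<Rightarrow> 'k)"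
  by unfold_locales (simp_all add: algebra_simps norm_mult scaleR_conv_of_real)


subsection \<open>R-bounds\<close>

definition rademacher_signs :: "nat \<Rightarrow> (nat \<Rightarrow> real) pmf" where
  "rademacher_signs N = Pi_pmf {..<N} 0 (\<lambda>_. pmf_of_set {1, -1})"

text \<open>The vectors \<open>\<xi> 0, \<dots>, \<xi> (N - 1)\<close> need not be distinct.\<close>

definition R_bounded_by :: "('k::real_normed_field \<Rightarrow> 'x::banach \<Rightarrow> 'x) \<Rightarrow> 'x set \<Rightarrow> real \<Rightarrow> bool" where
  "R_bounded_by smul S C \<longleftrightarrow>
     (\<forall>(N::nat) \<xi> lam. (\<forall>k<N. \<xi> k \<in> S) \<longrightarrow>
        sqrt (measure_pmf.expectation (rademacher_signs N)
                (\<lambda>\<epsilon>. (norm (\<Sum>k<N. \<epsilon> k *\<^sub>R smul (lam k) (\<xi> k)))\<^sup>2))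
          \<le> C * sqrt (\<Sum>k<N. (norm (lam k))\<^sup>2))"

definition R_bound :: "('k::real_normed_field \<Rightarrow> 'x::banach \<Rightarrow> 'x) \<Rightarrow> 'x set \<Rightarrow> ennreal" where
  "R_bound smul S = Inf {ennreal C | C. 0 \<le> C \<and> R_bounded_by smul S C}"


subsection \<open>Bochner integral and \<open>L\<^sup>p\<close>\<close>

text \<open>
  The library's \<^const>\<open>has_bochner_integral\<close> is restricted to second countable, i.e. separable, spaces.
  Its definition is repeated here for arbitrary Banach spaces, with Borel measurability replaced by
  strong measurability.
\<close>

definition strongly_measurable :: "'a measure \<Rightarrow> ('a \<Rightarrow> 'x::real_normed_vector) \<Rightarrow> bool" where
  "strongly_measurable M f \<longleftrightarrow>
     (\<exists>s. (\<forall>i. simple_function M (s i)) \<and> (AE x in M. (\<lambda>i. s i x) \<longlonglongrightarrow> f x))"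

definition has_strong_bochner_integral ::
    "'a measure \<Rightarrow> ('a \<Rightarrow> 'x::real_normed_vector) \<Rightarrow> 'x \<Rightarrow> bool" where
  "has_strong_bochner_integral M f I \<longleftrightarrow>
     strongly_measurable M f \<and>
     (\<exists>s. (\<forall>i. Bochner_Integration.simple_bochner_integrable M (s i)) \<and>
          (\<lambda>i. \<integral>\<^sup>+x. norm (f x - s i x) \<partial>M) \<longlonglongrightarrow> 0 \<and>
          (\<lambda>i. Bochner_Integration.simple_bochner_integral M (s i)) \<longlonglongrightarrow> I)"

definition strong_bochner_integral :: "'a measure \<Rightarrow> ('a \<Rightarrow> 'x::real_normed_vector) \<Rightarrow> 'x" where
  "strong_bochner_integral M f =
     (if \<exists>I. has_strong_bochner_integral M f I
      then THE I. has_strong_bochner_integral M f I else 0)"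

text \<open>Only used with \<open>p > 0\<close>.\<close>

definition ennreal_powr :: "ennreal \<Rightarrow> real \<Rightarrow> ennreal" where
  "ennreal_powr x p = (if x = \<infinity> then \<infinity> else ennreal (enn2real x powr p))"

definition Lp_norm :: "real \<Rightarrow> 'a measure \<Rightarrow> ('a \<Rightarrow> ennreal) \<Rightarrow> ennreal" where
  "Lp_norm p M g = ennreal_powr (\<integral>\<^sup>+x. ennreal_powr (g x) p \<partial>M) (1 / p)"

definition in_Lp :: "real \<Rightarrow> 'a measure \<Rightarrow> ('a \<Rightarrow> 'x::real_normed_vector) \<Rightarrow> bool" where
  "in_Lp p M f \<longleftrightarrow> strongly_measurable M f \<and> Lp_norm p M (\<lambda>x. ennreal (norm (f x))) < \<infinity>"

definition Lp_bounded ::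
    "real \<Rightarrow> 'a measure \<Rightarrow> (('a \<Rightarrow> 'x::real_normed_vector) \<Rightarrow> 'a \<Rightarrow> ennreal) \<Rightarrow> bool" where
  "Lp_bounded p M T \<longleftrightarrow>
     (\<exists>C::real. 0 \<le> C \<and>
        (\<forall>f. in_Lp p M f \<longrightarrow>
           Lp_norm p M (T f) \<le> ennreal C * Lp_norm p M (\<lambda>x. ennreal (norm (f x)))))"


subsection \<open>Dyadic systems\<close>

definition dyadic_parameter :: "(int \<Rightarrow> 'a::euclidean_space) \<Rightarrow> bool" where
  "dyadic_parameter \<beta> \<longleftrightarrow> (\<forall>j. \<forall>b\<in>Basis. \<beta> j \<bullet> b \<in> {0, 1})"

definition half_open_unit_cube :: "'a::euclidean_space set" where
  "half_open_unit_cube = {x. \<forall>b\<in>Basis. 0 \<le> x \<bullet> b \<and> x \<bullet> b < 1}"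

definition integer_points :: "'a::euclidean_space set" where
  "integer_points = {m. \<forall>b\<in>Basis. m \<bullet> b \<in> \<int>}"

definition dyadic_shift :: "(int \<Rightarrow> 'a::euclidean_space) \<Rightarrow> int \<Rightarrow> 'a" where
  "dyadic_shift \<beta> k = (\<Sum>\<^sub>\<infinity>j\<in>{k<..}. (2 powi (-j)) *\<^sub>R \<beta> j)"

definition dyadic_level :: "(int \<Rightarrow> 'a::euclidean_space) \<Rightarrow> int \<Rightarrow> 'a set set" where
  "dyadic_level \<beta> k =
     {(\<lambda>x. (2 powi (-k)) *\<^sub>R (x + m) + dyadic_shift \<beta> k) ` half_open_unit_cube | m. m \<in> integer_points}"

definition dyadic_system :: "(int \<Rightarrow> 'a::euclidean_space) \<Rightarrow> 'a set set" where
  "dyadic_system \<beta> = (\<Union>k. dyadic_level \<beta> k)"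

definition unit_interval_dyadics :: "real set set" where
  "unit_interval_dyadics = {I. I \<subseteq> {0..<1} \<and> (\<exists>k\<ge>0. I \<in> dyadic_level (\<lambda>_. 0) k)}"


subsection \<open>The Rademacher maximal function\<close>

definition average :: "('a::euclidean_space \<Rightarrow> 'x::banach) \<Rightarrow> 'a set \<Rightarrow> 'x" where
  "average f Q = (1 / measure lebesgue Q) *\<^sub>R strong_bochner_integral (lebesgue_on Q) f"

definition rademacher_maximal ::
    "('k::real_normed_field \<Rightarrow> 'x::banach \<Rightarrow> 'x) \<Rightarrow> 'a::euclidean_space set set \<Rightarrow>
     ('a \<Rightarrow> 'x) \<Rightarrow> 'a \<Rightarrow> ennreal" where
  "rademacher_maximal smul D f x = R_bound smul {average f Q | Q. Q \<in> D \<and> x \<in> Q}"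

end

theory Submission
  imports Defs
begin

text \<open>
  All three statements are equivalent to one discrete statement about finite \<open>b\<close>-ary trees, with \<open>b = 2 ^ n\<close>
  on \<open>\<real>\<^sup>n\<close> and \<open>b = 2\<close> on \<open>\<real>\<close> and \<open>[0, 1)\<close>: for functions on the leaves of a tree of depth \<open>N\<close>, the R-bounds of the
  averages over the ancestors of a leaf are \<open>L\<^sup>p\<close> bounded uniformly in \<open>N\<close>. Functions constant on the leaves
  below a single cube show necessity; conversely, only finitely many levels are seen at a time, where
  \<open>f\<close> may be replaced by its leaf averages (Jensen), and monotone convergence removes the truncation,
  because R-bounds are continuous along increasing unions.

  The \<open>2\<^sup>n\<close>-ary tree consists of every \<open>n\<close>-th level of a binary tree, so the binary bound implies the
  \<open>2\<^sup>n\<close>-ary one. Conversely the levels of the binary tree split into \<open>n\<close> residue classes modulo \<open>n\<close>, each of which is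
  controlled by \<open>2\<^sup>n\<close>-ary trees, and the R-bound of a union of \<open>n\<close> sets is at most the sum of their R-bounds.
\<close>

subsection \<open>Powers of extended nonnegative reals\<close>

text \<open>A tree records only nesting, the branching number and the equality of the volumes of
  siblings. The digits \<open>\<beta>\<close> affect none of these, so all dyadic systems of one
  dimension lead to the same discrete inequality. A dyadic system need not exhaust the space by one
  increasing sequence of cubes: for \<open>\<beta> = 0\<close>, cubes in different orthants have no
  common ancestor. Hence no single tree suffices, and the estimate is added up over the cubes of the
  coarsest level in sight, with a constant independent of that level. The values lie in an
  arbitrary, possibly nonseparable, Banach space, where measurability means being an a.e. limit of
  simple functions; completeness of Lebesgue measure turns this into measurability of the norms. The
  maximal function is not assumed measurable either: its \<open>p\<close>-th power is reached as a
  supremum of functions that are constant on small cubes.\<close>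

lemma ennreal_powr_ennreal: "0 \<le> r \<Longrightarrow> ennreal_powr (ennreal r) p = ennreal (r powr p)"
  by (simp add: ennreal_powr_def)

lemma ennreal_powr_mono:
  assumes "0 < p" "x \<le> y"
  shows "ennreal_powr x p \<le> ennreal_powr y p"
proof (cases "y = \<infinity>")
  case False
  then have "x \<noteq> \<infinity>" using assms(2) by (auto simp: top_unique)
  then show ?thesis using False assms
    by (auto simp: ennreal_powr_def intro!: ennreal_leI powr_mono2 enn2real_mono simp: less_top)
qed (simp add: ennreal_powr_def)

lemma ennreal_powr_mult:
  assumes "0 < p"
  shows "ennreal_powr (x * y) p = ennreal_powr x p * ennreal_powr y p"
  using assms
  by (cases x; cases y) (auto simp: ennreal_powr_def powr_mult ennreal_mult[symmetric] enn2real_mult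
    ennreal_top_mult ennreal_mult_top)

lemma ennreal_powr_inverse:
  assumes "0 < p"
  shows "ennreal_powr (ennreal_powr x p) (1 / p) = x" "ennreal_powr (ennreal_powr x (1 / p)) p = x"
  using assms by (cases x; simp add: ennreal_powr_def powr_powr)+

text \<open>The powers with exponents \<open>p\<close> and \<open>1 / p\<close> are mutually inverse
  increasing maps. In this adjoint form, compatibility with suprema follows without a limit
  argument.\<close>

lemma ennreal_powr_le_iff:
  assumes "0 < p"
  shows "ennreal_powr x p \<le> y \<longleftrightarrow> x \<le> ennreal_powr y (1 / p)"
  using assms ennreal_powr_mono[of p x "ennreal_powr y (1 / p)"]
    ennreal_powr_mono[of "1 / p" "ennreal_powr x p" y] ennreal_powr_inverse[OF assms]
  by auto

lemma ennreal_powr_SUP: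
  assumes "0 < p"
  shows "ennreal_powr (SUP i\<in>I. x i) p = (SUP i\<in>I. ennreal_powr (x i) p)"
proof (rule antisym)
  show "ennreal_powr (SUP i\<in>I. x i) p \<le> (SUP i\<in>I. ennreal_powr (x i) p)"
    unfolding ennreal_powr_le_iff[OF assms]
    by (intro SUP_least, subst ennreal_powr_le_iff[OF assms, symmetric]) (rule SUP_upper)
qed (intro SUP_least ennreal_powr_mono assms SUP_upper)

text \<open>Each summand is at most the largest one, whose power occurs in the sum on the right. The
  constant is crude, but only its independence of \<open>x\<close> matters.\<close>

lemma ennreal_powr_sum_le:
  assumes "0 < p" "0 < n"
  shows "ennreal_powr (\<Sum>r<n. x r) p \<le> ennreal (real n powr p) * (\<Sum>r<n. ennreal_powr (x r) p)"
proof -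
  have "Max (x ` {..<n}) \<in> x ` {..<n}" using assms by (intro Max_in) auto
  then obtain r0 where r0: "r0 < n" "x r0 = Max (x ` {..<n})" by auto
  have "(\<Sum>r<n. x r) \<le> (\<Sum>r<n. x r0)" by (rule sum_mono) (simp add: r0)
  also have "\<dots> = ennreal (real n) * x r0" by (simp add: ennreal_of_nat_eq_real_of_nat)
  finally have "ennreal_powr (\<Sum>r<n. x r) p \<le> ennreal_powr (ennreal (real n) * x r0) p"
    by (rule ennreal_powr_mono[OF assms(1)])
  also have "\<dots> = ennreal (real n powr p) * ennreal_powr (x r0) p"
    by (simp add: ennreal_powr_mult[OF assms(1)] ennreal_powr_ennreal)
  also have "\<dots> \<le> ennreal (real n powr p) * (\<Sum>r<n. ennreal_powr (x r) p)"
    using r0 by (intro mult_left_mono member_le_sum) auto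
  finally show ?thesis .
qed

section \<open>\<open>L^p\<close> boundedness as an inequality between integrals of
  \<open>p\<close>-th powers\<close>

lemma Lp_norm_le_iff:
  assumes "0 < p" "0 \<le> C"
  shows "Lp_norm p M g \<le> ennreal C * Lp_norm p M h \<longleftrightarrow>
    (\<integral>\<^sup>+x. ennreal_powr (g x) p \<partial>M) \<le> ennreal (C powr p) * (\<integral>\<^sup>+x. ennreal_powr (h x) p \<partial>M)"
proof -
  have *: "ennreal C * Lp_norm p M h =
      ennreal_powr (ennreal (C powr p) * (\<integral>\<^sup>+x. ennreal_powr (h x) p \<partial>M)) (1 / p)"
    using assms by (subst ennreal_powr_mult)
      (simp_all add: Lp_norm_def ennreal_powr_ennreal powr_powr)
  show ?thesis
    unfolding * unfolding Lp_norm_def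
    using ennreal_powr_le_iff[of "1 / p"] assms ennreal_powr_inverse[OF assms(1)] by simp
qed

lemma Lp_bounded_iff:
  fixes T :: "('a \<Rightarrow> 'x::real_normed_vector) \<Rightarrow> 'a \<Rightarrow> ennreal"
  assumes "0 < p"
  shows "Lp_bounded p M T \<longleftrightarrow> (\<exists>C::real. 0 \<le> C \<and> (\<forall>f. in_Lp p M f \<longrightarrow>
    (\<integral>\<^sup>+x. ennreal_powr (T f x) p \<partial>M) \<le> ennreal C * (\<integral>\<^sup>+x. ennreal (norm (f x) powr p) \<partial>M)))"
    (is "?L \<longleftrightarrow> (\<exists>C. ?R C)")
proof
  assume ?L
  then obtain C where "0 \<le> C" and C: "\<And>f. in_Lp p M f \<Longrightarrow>
      Lp_norm p M (T f) \<le> ennreal C * Lp_norm p M (\<lambda>x. ennreal (norm (f x)))"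
    unfolding Lp_bounded_def by blast
  then have "?R (C powr p)"
    by (simp add: Lp_norm_le_iff[OF assms \<open>0 \<le> C\<close>] ennreal_powr_ennreal)
  then show "\<exists>C. ?R C" ..
next
  assume "\<exists>C. ?R C"
  then obtain C where "0 \<le> C" and C: "?R C" by blast
  show ?L
    unfolding Lp_bounded_def
  proof (intro exI[of _ "C powr (1 / p)"] conjI allI impI)
    fix f :: "'a \<Rightarrow> 'x" assume "in_Lp p M f"
    then show "Lp_norm p M (T f) \<le> ennreal (C powr (1 / p)) * Lp_norm p M (\<lambda>x. ennreal (norm (f x)))"
      using C assms \<open>0 \<le> C\<close> by (subst Lp_norm_le_iff) (auto simp: powr_powr ennreal_powr_ennreal)
  qed simp
qed

lemma in_Lp_iff:
  assumes "0 < p"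
  shows "in_Lp p M f \<longleftrightarrow> strongly_measurable M f \<and> (\<integral>\<^sup>+x. ennreal (norm (f x) powr p) \<partial>M) < \<infinity>"
  by (auto simp: in_Lp_def Lp_norm_def ennreal_powr_ennreal ennreal_powr_def[of _ "1 / p"] less_top)

text \<open>Averaging this tangent-line bound over \<open>t\<close> gives Jensen's inequality.\<close>

lemma powr_tangent_le:
  fixes a t p :: real
  assumes "1 < p" "0 \<le> a" "0 \<le> t"
  shows "a powr p + p * a powr (p - 1) * (t - a) \<le> t powr p"
proof (cases "a = 0")
  case False
  show ?thesis
  proof (cases "t = 0")
    \<comment> \<open>The tangent argument is run on the open half-line, so the end point
      \<open>t = 0\<close> is computed by hand: the left side is
      \<open>(1 - p) * a powr p\<close>.\<close>
    case True
    have "a powr p = a powr (p - 1) * a" using False assms by (simp add: powr_mult_base' powr_diff)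
    then have "a powr p + p * a powr (p - 1) * (t - a) = (1 - p) * a powr p"
      using True by (simp add: algebra_simps)
    also have "\<dots> \<le> 0" using assms by (intro mult_nonpos_nonneg) auto
    finally show ?thesis using True assms by simp
  next
    case t: False
    have "convex_on {0<..} (\<lambda>t::real. t powr p)"
      using assms by (intro powr_convex) auto
    then have "p * a powr (p - 1) * (t - a) \<le> t powr p - a powr p"
    proof (rule convex_on_imp_above_tangent)
      have "((\<lambda>t. t powr p) has_real_derivative p * a powr (p - 1)) (at a)"
        using False assms by (auto intro!: derivative_eq_intros)
      then show "((\<lambda>t. t powr p) has_real_derivative p * a powr (p - 1)) (at a within {0<..})"
        by (rule has_field_derivative_at_within)
    qed (use False t assms in \<open>auto simp: interior_open\<close>)
    then show ?thesis by simp
  qed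
qed (use assms in simp)

subsection \<open>R-bounds\<close>

lemma finite_set_rademacher_signs: "finite (set_pmf (rademacher_signs N))"
  unfolding rademacher_signs_def by (subst set_Pi_pmf) (auto intro!: finite_PiE_dflt)

text \<open>Only finitely many sign patterns have positive probability, so with the weights
  \<open>sqrt (pmf ...)\<close> the root mean square is a Euclidean norm on a finite set, where the
  triangle inequality is available.\<close>

lemma rademacher_signs_Minkowski:
  fixes U V :: "(nat \<Rightarrow> real) \<Rightarrow> 'x::real_normed_vector"
  shows "sqrt (measure_pmf.expectation (rademacher_signs N) (\<lambda>\<epsilon>. (norm (U \<epsilon> + V \<epsilon>))\<^sup>2))
    \<le> sqrt (measure_pmf.expectation (rademacher_signs N) (\<lambda>\<epsilon>. (norm (U \<epsilon>))\<^sup>2)) +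
      sqrt (measure_pmf.expectation (rademacher_signs N) (\<lambda>\<epsilon>. (norm (V \<epsilon>))\<^sup>2))"
proof -
  let ?A = "set_pmf (rademacher_signs N)"
  have E: "sqrt (measure_pmf.expectation (rademacher_signs N) (\<lambda>\<epsilon>. (g \<epsilon>)\<^sup>2)) =
      L2_set (\<lambda>\<epsilon>. sqrt (pmf (rademacher_signs N) \<epsilon>) * g \<epsilon>) ?A" for g
    by (subst integral_measure_pmf[OF finite_set_rademacher_signs])
      (auto simp: L2_set_def power_mult_distrib)
  have "L2_set (\<lambda>\<epsilon>. sqrt (pmf (rademacher_signs N) \<epsilon>) * norm (U \<epsilon> + V \<epsilon>)) ?A \<le>
      L2_set (\<lambda>\<epsilon>. sqrt (pmf (rademacher_signs N) \<epsilon>) * norm (U \<epsilon>) +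
        sqrt (pmf (rademacher_signs N) \<epsilon>) * norm (V \<epsilon>)) ?A"
    by (rule L2_set_mono) (auto simp: ring_distribs(1)[symmetric] intro!: mult_left_mono norm_triangle_ineq)
  also have "\<dots> \<le> L2_set (\<lambda>\<epsilon>. sqrt (pmf (rademacher_signs N) \<epsilon>) * norm (U \<epsilon>)) ?A +
      L2_set (\<lambda>\<epsilon>. sqrt (pmf (rademacher_signs N) \<epsilon>) * norm (V \<epsilon>)) ?A"
    by (rule L2_set_triangle_ineq)
  finally show ?thesis by (simp add: E)
qed

lemma R_bounded_byD:
  assumes "R_bounded_by smul S C" "\<And>k. k < N \<Longrightarrow> \<xi> k \<in> S"
  shows "sqrt (measure_pmf.expectation (rademacher_signs N)
      (\<lambda>\<epsilon>. (norm (\<Sum>k<N. \<epsilon> k *\<^sub>R smul (lam k) (\<xi> k)))\<^sup>2)) \<le> C * sqrt (\<Sum>k<N. (norm (lam k))\<^sup>2)"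
  using assms unfolding R_bounded_by_def by blast

lemma R_bounded_by_mono: "R_bounded_by smul S C \<Longrightarrow> S' \<subseteq> S \<Longrightarrow> R_bounded_by smul S' C"
  unfolding R_bounded_by_def by blast

lemma R_bound_mono: "S' \<subseteq> S \<Longrightarrow> R_bound smul S' \<le> R_bound smul S"
  unfolding R_bound_def by (rule Inf_superset_mono) (blast intro: R_bounded_by_mono)

text \<open>The infimum is attained: every \<open>C + e\<close> with \<open>e > 0\<close> is
  admissible, and the defining inequality survives the limit as \<open>e\<close> tends to 0.\<close>

lemma R_bound_le_iff:
  fixes smul :: "'k::real_normed_field \<Rightarrow> 'x::banach \<Rightarrow> 'x"
  assumes "0 \<le> C"
  shows "R_bound smul S \<le> ennreal C \<longleftrightarrow> R_bounded_by smul S C"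
proof
  assume "R_bounded_by smul S C"
  then show "R_bound smul S \<le> ennreal C" using assms unfolding R_bound_def by (intro Inf_lower) auto
next
  assume L: "R_bound smul S \<le> ennreal C"
  have *: "R_bounded_by smul S (C + e)" if "0 < e" for e
  proof -
    have "R_bound smul S < ennreal (C + e)"
      using L that assms by (meson ennreal_lessI le_less_trans less_add_same_cancel1 add_nonneg_pos)
    then obtain D where D: "0 \<le> D" "R_bounded_by smul S D" "ennreal D < ennreal (C + e)"
      unfolding R_bound_def Inf_less_iff by auto
    then have "D \<le> C + e" using assms that by (simp add: ennreal_less_iff del: ennreal_plus)
    with D(2) show ?thesis unfolding R_bounded_by_def
      by (meson order_trans mult_right_mono real_sqrt_ge_zero sum_nonneg zero_le_power2)
  qed
  show "R_bounded_by smul S C"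
    unfolding R_bounded_by_def
  proof (intro allI impI)
    fix N :: nat and \<xi> :: "nat \<Rightarrow> 'x" and lam :: "nat \<Rightarrow> 'k" assume \<xi>: "\<forall>k<N. \<xi> k \<in> S"
    let ?E = "sqrt (measure_pmf.expectation (rademacher_signs N)
                (\<lambda>\<epsilon>. (norm (\<Sum>k<N. \<epsilon> k *\<^sub>R smul (lam k) (\<xi> k)))\<^sup>2))"
    let ?L = "sqrt (\<Sum>k<N. (norm (lam k))\<^sup>2)"
    have "?E \<le> (C + e) * ?L" if "0 < e" for e
      using *[OF that] \<xi> unfolding R_bounded_by_def by blast
    moreover have "((\<lambda>e. (C + e) * ?L) \<longlongrightarrow> (C + 0) * ?L) (at_right 0)"
      by (intro tendsto_intros)
    ultimately have "?E \<le> (C + 0) * ?L"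
      by (intro tendsto_lowerbound[where F = "at_right 0"])
        (auto simp: eventually_at_right_field intro!: exI[of _ 1])
    then show "?E \<le> C * ?L" by simp
  qed
qed

text \<open>A finite test family splits into its members in \<open>S\<close> and the others, which
  lie in \<open>T\<close>. Minkowski's inequality over the signs separates the two sums, and neither
  coefficient sum exceeds the original one.\<close>

lemma (in banach_over) R_bound_Un: "R_bound smul (S \<union> T) \<le> R_bound smul S + R_bound smul T"
proof (cases "R_bound smul S = \<infinity> \<or> R_bound smul T = \<infinity>")
  case False
  then obtain a b where ab: "R_bound smul S = ennreal a" "0 \<le> a" "R_bound smul T = ennreal b" "0 \<le> b"
    by (cases "R_bound smul S"; cases "R_bound smul T") auto
  have bound: "sqrt (measure_pmf.expectation (rademacher_signs N)
        (\<lambda>\<epsilon>. (norm (\<Sum>k<N. \<epsilon> k *\<^sub>R smul (if P k then lam k else 0) (\<xi> k)))\<^sup>2)) \<le>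
      c * sqrt (\<Sum>k<N. (norm (lam k))\<^sup>2)"
    if U: "R_bound smul U \<le> ennreal c" "0 \<le> c" "\<And>k. k < N \<Longrightarrow> P k \<Longrightarrow> \<xi> k \<in> U"
    for U c N P \<xi> and lam :: "nat \<Rightarrow> 'k"
  proof (cases "\<exists>k<N. P k")
    case True
    then obtain k0 where k0: "k0 < N" "P k0" by blast
    \<comment> \<open>Terms are deleted by zero coefficients, so that the same \<open>N\<close>
      signs serve both halves. The vectors at the deleted indices must still lie in
      \<open>U\<close>, hence the substitute \<open>\<xi> k0\<close>.\<close>
    let ?l = "\<lambda>k. if P k then lam k else 0" and ?x = "\<lambda>k. if P k then \<xi> k else \<xi> k0"
    have e: "(\<Sum>k<N. \<epsilon> k *\<^sub>R smul (?l k) (?x k)) = (\<Sum>k<N. \<epsilon> k *\<^sub>R smul (?l k) (\<xi> k))" for \<epsilon>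
      by (intro sum.cong) auto
    have "sqrt (measure_pmf.expectation (rademacher_signs N)
        (\<lambda>\<epsilon>. (norm (\<Sum>k<N. \<epsilon> k *\<^sub>R smul (?l k) (\<xi> k)))\<^sup>2)) \<le> c * sqrt (\<Sum>k<N. (norm (?l k))\<^sup>2)"
      unfolding e[symmetric] using U k0 by (intro R_bounded_byD[of smul U]) (auto simp flip: R_bound_le_iff)
    also have "\<dots> \<le> c * sqrt (\<Sum>k<N. (norm (lam k))\<^sup>2)"
      using U(2) by (intro mult_left_mono real_sqrt_le_mono sum_mono) auto
    finally show ?thesis .
  next
    case False
    then have "(\<Sum>k<N. \<epsilon> k *\<^sub>R smul (if P k then lam k else 0) (\<xi> k)) = 0" for \<epsilon>
      by (intro sum.neutral) auto
    then show ?thesis using U(2) by (simp add: sum_nonneg cong del: if_weak_cong)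
  qed
  have "R_bounded_by smul (S \<union> T) (a + b)"
    unfolding R_bounded_by_def
  proof (intro allI impI)
    fix N :: nat and \<xi> :: "nat \<Rightarrow> 'x" and lam :: "nat \<Rightarrow> 'k" assume \<xi>: "\<forall>k<N. \<xi> k \<in> S \<union> T"
    let ?L = "sqrt (\<Sum>k<N. (norm (lam k))\<^sup>2)"
    let ?U = "\<lambda>\<epsilon>. \<Sum>k<N. \<epsilon> k *\<^sub>R smul (if \<xi> k \<in> S then lam k else 0) (\<xi> k)"
    let ?V = "\<lambda>\<epsilon>. \<Sum>k<N. \<epsilon> k *\<^sub>R smul (if \<xi> k \<notin> S then lam k else 0) (\<xi> k)"
    have "(\<Sum>k<N. \<epsilon> k *\<^sub>R smul (lam k) (\<xi> k)) = ?U \<epsilon> + ?V \<epsilon>" for \<epsilon>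
      by (subst sum.distrib[symmetric]) (intro sum.cong; auto)
    then have "sqrt (measure_pmf.expectation (rademacher_signs N)
          (\<lambda>\<epsilon>. (norm (\<Sum>k<N. \<epsilon> k *\<^sub>R smul (lam k) (\<xi> k)))\<^sup>2))
        \<le> sqrt (measure_pmf.expectation (rademacher_signs N) (\<lambda>\<epsilon>. (norm (?U \<epsilon>))\<^sup>2)) +
          sqrt (measure_pmf.expectation (rademacher_signs N) (\<lambda>\<epsilon>. (norm (?V \<epsilon>))\<^sup>2))"
      using rademacher_signs_Minkowski[of N ?U ?V] by simp
    also have "\<dots> \<le> a * ?L + b * ?L"
      using \<xi> ab by (intro add_mono bound[of S] bound[of T]) auto
    finally show "sqrt (measure_pmf.expectation (rademacher_signs N)
          (\<lambda>\<epsilon>. (norm (\<Sum>k<N. \<epsilon> k *\<^sub>R smul (lam k) (\<xi> k)))\<^sup>2)) \<le> (a + b) * ?L"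
      by (simp add: algebra_simps)
  qed
  then have "R_bound smul (S \<union> T) \<le> ennreal (a + b)" using ab by (subst R_bound_le_iff) auto
  then show ?thesis using ab by simp
qed auto

lemma R_bound_empty:
  fixes smul :: "'k::real_normed_field \<Rightarrow> 'x::banach \<Rightarrow> 'x"
  shows "R_bound smul {} = 0"
proof -
  have "R_bounded_by smul {} 0" unfolding R_bounded_by_def
  proof (intro allI impI)
    fix N :: nat and \<xi> :: "nat \<Rightarrow> 'x" and lam :: "nat \<Rightarrow> 'k" assume "\<forall>k<N. \<xi> k \<in> {}"
    then have "N = 0" by auto
    then show "sqrt (measure_pmf.expectation (rademacher_signs N)
      (\<lambda>\<epsilon>. (norm (\<Sum>k<N. \<epsilon> k *\<^sub>R smul (lam k) (\<xi> k)))\<^sup>2)) \<le> 0 * sqrt (\<Sum>k<N. (norm (lam k))\<^sup>2)"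
      by simp
  qed
  then have "R_bound smul {} \<le> ennreal 0" by (subst R_bound_le_iff) auto
  then show ?thesis by simp
qed

lemma (in banach_over) R_bound_UN_le:
  fixes n :: nat
  shows "R_bound smul (\<Union>r<n. S r) \<le> (\<Sum>r<n. R_bound smul (S r))"
proof (induction n)
  case (Suc n)
  have "R_bound smul (\<Union>r<Suc n. S r) = R_bound smul ((\<Union>r<n. S r) \<union> S n)"
    by (simp add: lessThan_Suc Un_commute)
  also have "\<dots> \<le> R_bound smul (\<Union>r<n. S r) + R_bound smul (S n)" by (rule R_bound_Un)
  also have "\<dots> \<le> (\<Sum>r<Suc n. R_bound smul (S r))" using Suc by (auto intro: add_right_mono)
  finally show ?case .
qed (simp add: R_bound_empty)

text \<open>A test family has only finitely many vectors, so it already lies in a single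
  \<open>S K\<close>.\<close>

lemma R_bound_UN_incseq:
  fixes smul :: "'k::real_normed_field \<Rightarrow> 'x::banach \<Rightarrow> 'x" and S :: "nat \<Rightarrow> 'x::banach set"
  assumes "incseq S"
  shows "R_bound smul (\<Union>K. S K) = (SUP K. R_bound smul (S K))"
proof (rule antisym)
  show "R_bound smul (\<Union>K. S K) \<le> (SUP K. R_bound smul (S K))"
  proof (cases "(SUP K. R_bound smul (S K))")
    case (real c)
    have S: "R_bounded_by smul (S K) c" for K
      using real by (subst R_bound_le_iff[symmetric]) (auto intro: SUP_upper simp flip: real(2))
    have "R_bounded_by smul (\<Union>K. S K) c"
      unfolding R_bounded_by_def
    proof (intro allI impI)
      fix N :: nat and \<xi> :: "nat \<Rightarrow> 'x" and lam :: "nat \<Rightarrow> 'k" assume "\<forall>k<N. \<xi> k \<in> (\<Union>K. S K)"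
      then obtain K where K: "\<And>k. k < N \<Longrightarrow> \<xi> k \<in> S (K k)" by (auto simp: Bex_def) metis
      have "\<xi> k \<in> S (Max (K ` {..<N}))" if "k < N" for k
        using K[OF that] incseqD[OF assms Max_ge[of "K ` {..<N}" "K k"]] that by auto
      then show "sqrt (measure_pmf.expectation (rademacher_signs N)
          (\<lambda>\<epsilon>. (norm (\<Sum>k<N. \<epsilon> k *\<^sub>R smul (lam k) (\<xi> k)))\<^sup>2)) \<le> c * sqrt (\<Sum>k<N. (norm (lam k))\<^sup>2)"
        using S unfolding R_bounded_by_def by blast
    qed
    then show ?thesis using real by (simp add: R_bound_le_iff)
  next
    case top
    then show ?thesis by (metis top_greatest)
  qed
qed (intro SUP_least R_bound_mono UN_upper; simp)

subsection \<open>The discrete maximal operator\<close>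

text \<open>The leaves are numbered so that those below one node are consecutive; leaf
  \<open>i\<close> lies below node \<open>i div s\<close>. This is the conditional expectation onto
  the level whose nodes have \<open>s\<close> leaves each.\<close>

definition block_mean :: "nat \<Rightarrow> (nat \<Rightarrow> 'x::real_vector) \<Rightarrow> nat \<Rightarrow> 'x" where
  "block_mean s f q = (1 / real s) *\<^sub>R (\<Sum>l<s. f (s * q + l))"

text \<open>The Rademacher maximal inequality for a \<open>b\<close>-adic filtration with
  \<open>N + 1\<close> levels. Counting measure stands in for the uniform probability, as a common
  factor cancels; what matters is that \<open>C\<close> is uniform in \<open>N\<close>.\<close>

definition tree_bounded :: "('k::real_normed_field \<Rightarrow> 'x::banach \<Rightarrow> 'x) \<Rightarrow> real \<Rightarrow> nat \<Rightarrow> bool" where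
  "tree_bounded smul p b \<longleftrightarrow> (\<exists>C::real. 0 \<le> C \<and> (\<forall>N f.
     (\<Sum>i<b ^ N. ennreal_powr (R_bound smul {block_mean (b ^ m) f (i div b ^ m) | m. m \<le> N}) p)
       \<le> ennreal C * (\<Sum>i<b ^ N. ennreal (norm (f i) powr p))))"

lemma sum_blocks: 
  fixes f :: "nat \<Rightarrow> 'x::comm_monoid_add"
  shows "(\<Sum>i<s * t. f i) = (\<Sum>q<t. \<Sum>l<s. f (s * q + l))"
proof -
  have "(\<Sum>i<s * t. f i) = (\<Sum>q<t. sum f {q * s..<q * s + s})"
    by (simp add: sum.nat_group mult.commute)
  also have "\<dots> = (\<Sum>q<t. \<Sum>l<s. f (s * q + l))"
  proof (rule sum.cong)
    fix q show "sum f {q * s..<q * s + s} = (\<Sum>l<s. f (s * q + l))"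
      using sum.shift_bounds_nat_ivl[of f 0 "q * s" s] by (simp add: ac_simps lessThan_atLeast0)
  qed simp
  finally show ?thesis .
qed

lemma block_mean_1: "block_mean (Suc 0) f = f"
  by (simp add: block_mean_def fun_eq_iff)

text \<open>Tower property: blocks of one level have equal length, so a mean of means is the mean
  over the union.\<close>

lemma block_mean_block_mean: "block_mean s (block_mean t f) q = block_mean (t * s) f q"
  unfolding block_mean_def scaleR_sum_right[symmetric] scaleR_scaleR sum_blocks[of _ t s]
  by (simp add: algebra_simps)

text \<open>The tangent-line bound at \<open>norm (block_mean s f q)\<close> is summed over the
  block. The linear terms have a nonnegative sum, because the norm of a mean is at most the mean of
  the norms.\<close>

lemma block_mean_Jensen:
  fixes f :: "nat \<Rightarrow> 'x::real_normed_vector"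
  assumes "1 < p" "0 < s"
  shows "real s * norm (block_mean s f q) powr p \<le> (\<Sum>l<s. norm (f (s * q + l)) powr p)"
proof -
  let ?a = "norm (block_mean s f q)" and ?t = "\<lambda>l. norm (f (s * q + l))"
  have *: "real s * ?a \<le> (\<Sum>l<s. ?t l)"
    using assms norm_sum[of "\<lambda>l. f (s * q + l)" "{..<s}"] by (simp add: block_mean_def)
  have "real s * ?a powr p \<le> real s * ?a powr p + p * ?a powr (p - 1) * ((\<Sum>l<s. ?t l) - real s * ?a)"
    using * assms by simp
  also have "\<dots> = (\<Sum>l<s. ?a powr p + p * ?a powr (p - 1) * (?t l - ?a))"
    by (simp add: sum.distrib sum_distrib_left[symmetric] sum_subtractf)
  also have "\<dots> \<le> (\<Sum>l<s. ?t l powr p)"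
    using assms by (intro sum_mono powr_tangent_le) auto
  finally show ?thesis .
qed

text \<open>The levels of the \<open>b\<close>-ary tree split into the \<open>n\<close> residue classes modulo \<open>n\<close>; the levels
  \<open>r, r + n, r + 2n, \<dots>\<close> are those of a \<open>b\<^sup>n\<close>-ary tree for the function coarsened by \<open>block_mean (b ^ r)\<close>.\<close>

lemma (in banach_over) tree_bounded_power:
  assumes "1 < p" "0 < n" "0 < b"
  shows "tree_bounded smul p (b ^ n) \<longleftrightarrow> tree_bounded smul p b"
proof
  assume "tree_bounded smul p b"
  then obtain C where C: "0 \<le> C" "\<And>N f.
     (\<Sum>i<b ^ N. ennreal_powr (R_bound smul {block_mean (b ^ m) f (i div b ^ m) | m. m \<le> N}) p)
       \<le> ennreal C * (\<Sum>i<b ^ N. ennreal (norm (f i) powr p))"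
    unfolding tree_bounded_def by blast
  show "tree_bounded smul p (b ^ n)"
    unfolding tree_bounded_def
  proof (intro exI[of _ C] conjI allI)
    fix N and f :: "nat \<Rightarrow> 'x"
    have "(\<Sum>i<(b ^ n) ^ N. ennreal_powr (R_bound smul {block_mean ((b ^ n) ^ m) f (i div (b ^ n) ^ m) | m. m \<le> N}) p)
      \<le> (\<Sum>i<b ^ (n * N). ennreal_powr (R_bound smul {block_mean (b ^ m) f (i div b ^ m) | m. m \<le> n * N}) p)"
      unfolding power_mult[symmetric] using assms
      by (intro sum_mono ennreal_powr_mono R_bound_mono) (auto intro: mult_le_mono2)
    also have "\<dots> \<le> ennreal C * (\<Sum>i<b ^ (n * N). ennreal (norm (f i) powr p))"
      by (rule C)
    finally show "(\<Sum>i<(b ^ n) ^ N. ennreal_powr (R_bound smul {block_mean ((b ^ n) ^ m) f (i div (b ^ n) ^ m) | m. m \<le> N}) p)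
      \<le> ennreal C * (\<Sum>i<(b ^ n) ^ N. ennreal (norm (f i) powr p))" by (simp add: power_mult)
  qed (rule C)
next
  assume "tree_bounded smul p (b ^ n)"
  then obtain C where C: "0 \<le> C" "\<And>N f.
     (\<Sum>i<(b ^ n) ^ N. ennreal_powr (R_bound smul {block_mean ((b ^ n) ^ m) f (i div (b ^ n) ^ m) | m. m \<le> N}) p)
       \<le> ennreal C * (\<Sum>i<(b ^ n) ^ N. ennreal (norm (f i) powr p))"
    unfolding tree_bounded_def by blast
  show "tree_bounded smul p b"
    unfolding tree_bounded_def
  \<comment> \<open>\<open>real n powr p\<close> is the price of taking the \<open>p\<close>-th
    power of a sum of \<open>n\<close> R-bounds; \<open>real n * C\<close> collects one
    \<open>C\<close> per residue class.\<close>
  proof (intro exI[of _ "real n powr p * (real n * C)"] conjI allI)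
    fix N and f0 :: "nat \<Rightarrow> 'x"
    \<comment> \<open>A \<open>B\<close>-ary tree of depth \<open>N\<close> over blocks of length
      \<open>b ^ r\<close> covers \<open>b ^ r * B ^ N\<close> leaves, possibly more than the given
      \<open>b ^ N\<close>. Extension by zero fills the surplus at no cost on the right-hand
      side.\<close>
    define f where "f i = (if i < b ^ N then f0 i else 0)" for i
    define B where "B = b ^ n"
    define S where "S r i = {block_mean (B ^ m) (block_mean (b ^ r) f) (i div B ^ m) | m. m \<le> N}" for r i
    have sub: "{block_mean (b ^ m) f0 (i div b ^ m) | m. m \<le> N} \<subseteq> (\<Union>r<n. S r (i div b ^ r))"
      if i: "i < b ^ N" for i
    proof safe
      fix m assume "m \<le> N"
      \<comment> \<open>Level \<open>m\<close> is reached by coarsening \<open>m mod n\<close> times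
        and then climbing \<open>m div n\<close> levels of the \<open>B\<close>-ary tree.\<close>
      have m: "b ^ m = b ^ (m mod n) * B ^ (m div n)"
        unfolding B_def power_mult[symmetric] power_add[symmetric] by simp
      \<comment> \<open>A block of length \<open>b ^ m\<close> that meets the first
        \<open>b ^ N\<close> indices stays among them, so the extension by zero leaves its mean
        unchanged.\<close>
      have "b ^ m * (i div b ^ m) + l < b ^ N" if "l < b ^ m" for l
      proof -
        have N: "b ^ N = b ^ m * b ^ (N - m)" using \<open>m \<le> N\<close> by (simp flip: power_add)
        have "i div b ^ m < b ^ (N - m)" using i N by (simp add: less_mult_imp_div_less mult.commute)
        then have "b ^ m * (i div b ^ m) + b ^ m \<le> b ^ N"
          unfolding N by (metis Suc_leI mult_Suc_right mult_le_mono2 add.commute)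
        then show ?thesis using that by simp
      qed
      then have "block_mean (b ^ m) f0 (i div b ^ m) = block_mean (b ^ m) f (i div b ^ m)"
        by (simp add: block_mean_def f_def)
      also have "\<dots> = block_mean (B ^ (m div n)) (block_mean (b ^ (m mod n)) f) (i div b ^ (m mod n) div B ^ (m div n))"
        by (simp add: block_mean_block_mean m div_mult2_eq)
      finally have "block_mean (b ^ m) f0 (i div b ^ m) \<in> S (m mod n) (i div b ^ (m mod n))"
        unfolding S_def using \<open>m \<le> N\<close> by (auto intro!: exI[of _ "m div n"] le_trans[OF div_le_dividend])
      then show "block_mean (b ^ m) f0 (i div b ^ m) \<in> (\<Union>r<n. S r (i div b ^ r))"
        using assms by auto
    qed
    have r: "(\<Sum>i<b ^ N. ennreal_powr (R_bound smul (S r (i div b ^ r))) p)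
        \<le> ennreal C * (\<Sum>i<b ^ N. ennreal (norm (f0 i) powr p))" for r
    proof -
      let ?g = "block_mean (b ^ r) f"
      have le: "b ^ N \<le> b ^ r * B ^ N"
        unfolding B_def power_mult[symmetric] power_add[symmetric] using assms
        by (intro power_increasing) (auto intro: trans_le_add2)
      have "(\<Sum>i<b ^ N. ennreal_powr (R_bound smul (S r (i div b ^ r))) p)
        \<le> (\<Sum>i<b ^ r * B ^ N. ennreal_powr (R_bound smul (S r (i div b ^ r))) p)"
        using le by (intro sum_mono2) auto
      \<comment> \<open>The summand depends on \<open>i\<close> only through
        \<open>q = i div b ^ r\<close>, so each node is counted \<open>b ^ r\<close> times. Jensen's
        inequality absorbs this multiplicity below.\<close>
      also have "\<dots> = (\<Sum>q<B ^ N. ennreal (real (b ^ r)) * ennreal_powr (R_bound smul (S r q)) p)"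
        using assms by (subst sum_blocks) (simp add: ennreal_of_nat_eq_real_of_nat)
      also have "\<dots> \<le> ennreal (real (b ^ r)) * (ennreal C * (\<Sum>q<B ^ N. ennreal (norm (?g q) powr p)))"
        unfolding sum_distrib_left[symmetric] S_def B_def by (intro mult_left_mono C) simp
      also have "\<dots> = ennreal C * (\<Sum>q<B ^ N. ennreal (real (b ^ r) * norm (?g q) powr p))"
        by (simp add: ennreal_mult sum_distrib_left[symmetric] mult.left_commute del: sum_ennreal)
      also have "\<dots> \<le> ennreal C * (\<Sum>q<B ^ N. ennreal (\<Sum>l<b ^ r. norm (f (b ^ r * q + l)) powr p))"
        using assms by (intro mult_left_mono sum_mono ennreal_leI block_mean_Jensen) auto
      also have "\<dots> = ennreal C * (\<Sum>i<b ^ r * B ^ N. ennreal (norm (f i) powr p))"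
        by (subst sum_blocks) simp
      also have "(\<Sum>i<b ^ r * B ^ N. ennreal (norm (f i) powr p)) = (\<Sum>i<b ^ N. ennreal (norm (f i) powr p))"
        using le by (intro sum.mono_neutral_right) (auto simp: f_def)
      also have "\<dots> = (\<Sum>i<b ^ N. ennreal (norm (f0 i) powr p))" by (simp add: f_def)
      finally show ?thesis .
    qed
    have "(\<Sum>i<b ^ N. ennreal_powr (R_bound smul {block_mean (b ^ m) f0 (i div b ^ m) | m. m \<le> N}) p)
      \<le> (\<Sum>i<b ^ N. ennreal (real n powr p) * (\<Sum>r<n. ennreal_powr (R_bound smul (S r (i div b ^ r))) p))"
    proof (rule sum_mono)
      fix i assume "i \<in> {..<b ^ N}"
      then have "R_bound smul {block_mean (b ^ m) f0 (i div b ^ m) | m. m \<le> N}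
          \<le> R_bound smul (\<Union>r<n. S r (i div b ^ r))"
        by (intro R_bound_mono sub) simp
      also have "\<dots> \<le> (\<Sum>r<n. R_bound smul (S r (i div b ^ r)))" by (rule R_bound_UN_le)
      finally have "ennreal_powr (R_bound smul {block_mean (b ^ m) f0 (i div b ^ m) | m. m \<le> N}) p
          \<le> ennreal_powr (\<Sum>r<n. R_bound smul (S r (i div b ^ r))) p"
        using assms by (intro ennreal_powr_mono) auto
      also have "\<dots> \<le> ennreal (real n powr p) * (\<Sum>r<n. ennreal_powr (R_bound smul (S r (i div b ^ r))) p)"
        using assms by (intro ennreal_powr_sum_le) auto
      finally show "ennreal_powr (R_bound smul {block_mean (b ^ m) f0 (i div b ^ m) | m. m \<le> N}) p
          \<le> ennreal (real n powr p) * (\<Sum>r<n. ennreal_powr (R_bound smul (S r (i div b ^ r))) p)" .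
    qed
    also have "\<dots> = ennreal (real n powr p) * (\<Sum>r<n. \<Sum>i<b ^ N. ennreal_powr (R_bound smul (S r (i div b ^ r))) p)"
      by (subst sum.swap) (simp add: sum_distrib_left)
    also have "\<dots> \<le> ennreal (real n powr p) * (\<Sum>r<n. ennreal C * (\<Sum>i<b ^ N. ennreal (norm (f0 i) powr p)))"
      by (intro mult_left_mono sum_mono r) simp
    also have "\<dots> = ennreal (real n powr p * (real n * C)) * (\<Sum>i<b ^ N. ennreal (norm (f0 i) powr p))"
      using C(1) by (simp add: ennreal_mult ennreal_of_nat_eq_real_of_nat mult.assoc)
    finally show "(\<Sum>i<b ^ N. ennreal_powr (R_bound smul {block_mean (b ^ m) f0 (i div b ^ m) | m. m \<le> N}) p)
      \<le> ennreal (real n powr p * (real n * C)) * (\<Sum>i<b ^ N. ennreal (norm (f0 i) powr p))" .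
  qed (use C in simp)
qed

subsection \<open>The strong Bochner integral\<close>

lemma complete_measure_restrict_space:
  assumes "complete_measure M" "A \<in> sets M"
  shows "complete_measure (restrict_space M A)"
proof
  fix B C assume "B \<subseteq> C" "C \<in> null_sets (restrict_space M A)"
  then have "B \<subseteq> A" "C \<in> null_sets M"
    using assms(2) by (auto simp: null_sets_restrict_space)
  then have "B \<in> sets M" using complete_measure.complete[OF assms(1) \<open>B \<subseteq> C\<close>] by simp
  then show "B \<in> sets (restrict_space M A)"
    using assms(2) \<open>B \<subseteq> A\<close> by (subst sets_restrict_space_iff) (auto dest: sets.sets_into_space)
qed

text \<open>Preimages under \<open>f\<close> and \<open>g\<close> differ by a subset of a null set,
  measurable by completeness. Strong measurability controls a function only almost everywhere, and
  this closes the gap.\<close>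

lemma complete_measure_measurable_AE:
  assumes "complete_measure M" "g \<in> measurable M N" "AE x in M. f x = g x"
    and "\<And>x. x \<in> space M \<Longrightarrow> f x \<in> space N"
  shows "f \<in> measurable M N"
proof (rule measurableI)
  fix A assume "A \<in> sets N"
  show "f -` A \<inter> space M \<in> sets M"
  proof (rule complete_measure.in_sets_AE[OF assms(1)])
    show "AE x in M. (x \<in> g -` A \<inter> space M) = (x \<in> f -` A \<inter> space M)"
      using assms(3) by eventually_elim auto
  qed (use assms(2) \<open>A \<in> sets N\<close> in auto)
qed (use assms in auto)

lemma strongly_measurable_restrict_space:
  fixes f :: "'a \<Rightarrow> 'x::real_normed_vector"
  assumes "strongly_measurable M f" "A \<in> sets M"
  shows "strongly_measurable (restrict_space M A) f"
proof -
  obtain s where s: "\<And>i. simple_function M (s i)" "AE x in M. (\<lambda>i. s i x) \<longlonglongrightarrow> f x"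
    using assms unfolding strongly_measurable_def by blast
  have A: "A \<inter> space M \<in> sets M" using assms by auto
  have "simple_function (restrict_space M A) (s i)" for i
    unfolding simple_function_restrict_space[OF A]
    using assms s by (intro simple_function_compose2[where h = scaleR] simple_function_indicator) auto
  moreover have "AE x in restrict_space M A. (\<lambda>i. s i x) \<longlonglongrightarrow> f x"
    using s(2) by (subst AE_restrict_space_iff[OF A]) (auto elim: eventually_mono)
  ultimately show ?thesis unfolding strongly_measurable_def by blast
qed

text \<open>Almost everywhere the distance is a limit of distances between simple functions, which
  are measurable and real-valued; completeness absorbs the exceptional set.\<close>

lemma strongly_measurable_norm_diff:
  fixes f :: "'a \<Rightarrow> 'x::real_normed_vector"
  assumes "complete_measure M" "strongly_measurable M f" "simple_function M t"
  shows "(\<lambda>x. norm (f x - t x)) \<in> borel_measurable M"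
proof -
  obtain s where s: "\<And>i. simple_function M (s i)" "AE x in M. (\<lambda>i. s i x) \<longlonglongrightarrow> f x"
    using assms unfolding strongly_measurable_def by blast
  have [measurable]: "(\<lambda>x. norm (s i x - t x)) \<in> borel_measurable M" for i
    using s assms(3) by (intro borel_measurable_simple_function simple_function_compose2[where h = "\<lambda>x y. norm (x - y)"])
  show ?thesis
  proof (rule complete_measure_measurable_AE[OF assms(1)])
    show "(\<lambda>x. lim (\<lambda>i. norm (s i x - t x))) \<in> borel_measurable M" by measurable
    show "AE x in M. norm (f x - t x) = lim (\<lambda>i. norm (s i x - t x))"
      using s(2) by eventually_elim (intro limI[symmetric] tendsto_intros)
  qed simp
qed

lemma strongly_measurable_norm:
  fixes f :: "'a \<Rightarrow> 'x::real_normed_vector"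
  assumes "complete_measure M" "strongly_measurable M f"
  shows "(\<lambda>x. norm (f x)) \<in> borel_measurable M"
  using strongly_measurable_norm_diff[OF assms, of "\<lambda>_. 0"] by simp

text \<open>Both simple integrals are compared through \<open>f\<close>. This estimate yields
  uniqueness of the integral, the Cauchy property behind its existence and, with
  \<open>t = 0\<close>, the norm bound.\<close>

lemma simple_bochner_integral_dist_le:
  fixes f :: "'a \<Rightarrow> 'x::real_normed_vector"
  assumes "complete_measure M" "strongly_measurable M f"
    and s: "Bochner_Integration.simple_bochner_integrable M s"
    and t: "Bochner_Integration.simple_bochner_integrable M t"
  shows "ennreal (norm (Bochner_Integration.simple_bochner_integral M s - Bochner_Integration.simple_bochner_integral M t))
    \<le> (\<integral>\<^sup>+x. norm (f x - s x) \<partial>M) + (\<integral>\<^sup>+x. norm (f x - t x) \<partial>M)"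
proof -
  note d = simple_bochner_integrable_compose2[of "\<lambda>x y. x - y", OF _ s t]
  have [measurable]: "(\<lambda>x. norm (f x - s x)) \<in> borel_measurable M" "(\<lambda>x. norm (f x - t x)) \<in> borel_measurable M"
    using assms by (auto intro!: strongly_measurable_norm_diff elim: simple_bochner_integrable.cases)
  have "norm (Bochner_Integration.simple_bochner_integral M s - Bochner_Integration.simple_bochner_integral M t)
      \<le> Bochner_Integration.simple_bochner_integral M (\<lambda>x. norm (s x - t x))"
    unfolding simple_bochner_integral_diff[OF s t, symmetric]
    by (rule simple_bochner_integral_norm_bound) (simp add: d)
  then have "ennreal (norm (Bochner_Integration.simple_bochner_integral M s - Bochner_Integration.simple_bochner_integral M t))
      \<le> ennreal (Bochner_Integration.simple_bochner_integral M (\<lambda>x. norm (s x - t x)))"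
    by (rule ennreal_leI)
  also have "ennreal (Bochner_Integration.simple_bochner_integral M (\<lambda>x. norm (s x - t x))) = (\<integral>\<^sup>+x. norm (s x - t x) \<partial>M)"
    by (rule simple_bochner_integral_eq_nn_integral)
      (auto intro: simple_bochner_integrable_compose2[of "\<lambda>x y. norm (x - y)", OF _ s t])
  also have "(\<integral>\<^sup>+x. norm (s x - t x) \<partial>M) \<le> (\<integral>\<^sup>+x. ennreal (norm (f x - s x)) + ennreal (norm (f x - t x)) \<partial>M)"
    by (intro nn_integral_mono)
      (auto simp flip: ennreal_plus intro!: ennreal_leI norm_diff_triangle_le simp: norm_minus_commute)
  also have "\<dots> = (\<integral>\<^sup>+x. norm (f x - s x) \<partial>M) + (\<integral>\<^sup>+x. norm (f x - t x) \<partial>M)"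
    by (intro nn_integral_add) auto
  finally show ?thesis .
qed

section \<open>Uniqueness, existence and additivity of the integral\<close>

lemma tendsto_norm_0_ennreal:
  assumes "\<And>i. ennreal (norm (a i)) \<le> e i" "e \<longlonglongrightarrow> 0"
  shows "a \<longlonglongrightarrow> 0"
proof -
  have "(\<lambda>i. ennreal (norm (a i))) \<longlonglongrightarrow> ennreal 0"
    unfolding ennreal_0 by (rule tendsto_sandwich[OF _ _ tendsto_const assms(2)]) (use assms(1) in auto)
  then have "(\<lambda>i. norm (a i)) \<longlonglongrightarrow> 0" by (subst (asm) tendsto_ennreal_iff) auto
  then show ?thesis by (rule tendsto_norm_zero_cancel)
qed

text \<open>The definition provides one approximating sequence; comparison with it shows that every
  \<open>L^1\<close>-approximating sequence of simple functions computes the same value.\<close>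

lemma has_strong_bochner_integral_tendsto:
  fixes f :: "'a \<Rightarrow> 'x::real_normed_vector"
  assumes "complete_measure M" "has_strong_bochner_integral M f I"
    and t: "\<And>i. Bochner_Integration.simple_bochner_integrable M (t i)" "(\<lambda>i. \<integral>\<^sup>+x. norm (f x - t i x) \<partial>M) \<longlonglongrightarrow> 0"
  shows "(\<lambda>i. Bochner_Integration.simple_bochner_integral M (t i)) \<longlonglongrightarrow> I"
proof -
  obtain s where s: "strongly_measurable M f" "\<And>i. Bochner_Integration.simple_bochner_integrable M (s i)"
      "(\<lambda>i. \<integral>\<^sup>+x. norm (f x - s i x) \<partial>M) \<longlonglongrightarrow> 0"
      "(\<lambda>i. Bochner_Integration.simple_bochner_integral M (s i)) \<longlonglongrightarrow> I"
    using assms(2) unfolding has_strong_bochner_integral_def by blast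
  have "(\<lambda>i. Bochner_Integration.simple_bochner_integral M (t i) - Bochner_Integration.simple_bochner_integral M (s i)) \<longlonglongrightarrow> 0"
  proof (rule tendsto_norm_0_ennreal)
    show "(\<lambda>i. (\<integral>\<^sup>+x. norm (f x - t i x) \<partial>M) + (\<integral>\<^sup>+x. norm (f x - s i x) \<partial>M)) \<longlonglongrightarrow> 0"
      using tendsto_add[OF t(2) s(3)] by simp
  qed (intro simple_bochner_integral_dist_le assms s t)
  from tendsto_add[OF this s(4)] show ?thesis by simp
qed

lemma has_strong_bochner_integral_unique:
  fixes f :: "'a \<Rightarrow> 'x::real_normed_vector"
  assumes "complete_measure M" "has_strong_bochner_integral M f I" "has_strong_bochner_integral M f J"
  shows "I = J"
proof -
  obtain s where "\<And>i. Bochner_Integration.simple_bochner_integrable M (s i)"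
      "(\<lambda>i. \<integral>\<^sup>+x. norm (f x - s i x) \<partial>M) \<longlonglongrightarrow> 0"
      "(\<lambda>i. Bochner_Integration.simple_bochner_integral M (s i)) \<longlonglongrightarrow> I"
    using assms(2) unfolding has_strong_bochner_integral_def by blast
  then show ?thesis
    using has_strong_bochner_integral_tendsto[OF assms(1,3), of s] LIMSEQ_unique by blast
qed

lemma strong_bochner_integral_eq:
  fixes f :: "'a \<Rightarrow> 'x::real_normed_vector"
  assumes "complete_measure M" "has_strong_bochner_integral M f I"
  shows "strong_bochner_integral M f = I"
  unfolding strong_bochner_integral_def
  using assms has_strong_bochner_integral_unique[OF assms(1)] by (auto intro!: the_equality)

text \<open>Truncating the approximating simple functions at \<open>2 * norm (f x)\<close> makes them dominated.\<close>

lemma has_strong_bochner_integral_integrable: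
  fixes f :: "'a \<Rightarrow> 'x::banach"
  assumes M: "complete_measure M" and f: "strongly_measurable M f"
    and fin: "(\<integral>\<^sup>+x. norm (f x) \<partial>M) < \<infinity>"
  shows "has_strong_bochner_integral M f (strong_bochner_integral M f)"
proof -
  obtain s where s: "\<And>i. simple_function M (s i)" "AE x in M. (\<lambda>i. s i x) \<longlonglongrightarrow> f x"
    using f unfolding strongly_measurable_def by blast
  have [measurable]: "(\<lambda>x. norm (f x)) \<in> borel_measurable M" by (rule strongly_measurable_norm[OF M f])
  have [measurable]: "(\<lambda>x. norm (s i x)) \<in> borel_measurable M" for i
    using s by (intro borel_measurable_simple_function simple_function_compose1[where g = norm])
  define t where "t i x = (if norm (s i x) \<le> 2 * norm (f x) then s i x else 0)" for i x
  have t: "simple_function M (t i)" for i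
    unfolding t_def using s by (intro simple_function_If) auto
  have tf: "norm (t i x) \<le> 2 * norm (f x)" for i x by (simp add: t_def)
  have fin2: "(\<integral>\<^sup>+x. ennreal (c * norm (f x)) \<partial>M) < \<infinity>" if "0 \<le> c" for c
    using fin that by (simp add: ennreal_mult nn_integral_cmult ennreal_mult_less_top)
  have tint: "Bochner_Integration.simple_bochner_integrable M (t i)" for i
  proof (rule simple_bochner_integrableI_bounded[OF t])
    have "(\<integral>\<^sup>+x. norm (t i x) \<partial>M) \<le> (\<integral>\<^sup>+x. ennreal (2 * norm (f x)) \<partial>M)"
      by (intro nn_integral_mono ennreal_leI tf)
    then show "(\<integral>\<^sup>+x. norm (t i x) \<partial>M) < \<infinity>" using fin2[of 2] by simp
  qed
  have lim: "(\<lambda>i. \<integral>\<^sup>+x. norm (f x - t i x) \<partial>M) \<longlonglongrightarrow> (\<integral>\<^sup>+x. 0 \<partial>M)"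
  proof (rule nn_integral_dominated_convergence[where w = "\<lambda>x. ennreal (3 * norm (f x))"])
    show "(\<lambda>x. ennreal (norm (f x - t i x))) \<in> borel_measurable M" for i
      using strongly_measurable_norm_diff[OF M f t[of i]] by measurable
    have "norm (f x - t i x) \<le> 3 * norm (f x)" for i x
      using norm_triangle_ineq4[of "f x" "t i x"] tf[of i x] by linarith
    then show "AE x in M. ennreal (norm (f x - t i x)) \<le> ennreal (3 * norm (f x))" for i
      by (intro AE_I2 ennreal_leI)
    show "AE x in M. (\<lambda>i. ennreal (norm (f x - t i x))) \<longlonglongrightarrow> 0"
      using s(2)
    proof eventually_elim
      case (elim x)
      have "(\<lambda>i. t i x) \<longlonglongrightarrow> f x"
      proof (cases "f x = 0")
        \<comment> \<open>Where \<open>f x = 0\<close> the truncation admits only the value 0, so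
          \<open>t i x\<close> vanishes for every \<open>i\<close>.\<close>
        case True
        then show ?thesis by (simp add: t_def if_distrib cong: if_cong)
      next
        case False
        \<comment> \<open>The factor 2 leaves room above \<open>norm (f x) > 0\<close>, so the
          truncation is eventually inactive at \<open>x\<close>.\<close>
        have "(\<lambda>i. norm (s i x)) \<longlonglongrightarrow> norm (f x)" using elim by (rule tendsto_norm)
        then have "\<forall>\<^sub>F i in sequentially. norm (s i x) < 2 * norm (f x)"
          using False by (intro order_tendstoD) auto
        then have "\<forall>\<^sub>F i in sequentially. t i x = s i x" by eventually_elim (simp add: t_def)
        then show ?thesis using elim by (simp add: tendsto_cong)
      qed
      then have "(\<lambda>i. norm (f x - t i x)) \<longlonglongrightarrow> norm (f x - f x)" by (intro tendsto_intros)
      then show ?case by (subst ennreal_0[symmetric], intro tendsto_ennrealI) simp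
    qed
  qed (use fin2[of 3] in auto)
  then have lim0: "(\<lambda>i. \<integral>\<^sup>+x. norm (f x - t i x) \<partial>M) \<longlonglongrightarrow> 0" by simp
  have "Cauchy (\<lambda>i. Bochner_Integration.simple_bochner_integral M (t i))"
  proof (rule metric_CauchyI)
    fix e :: real assume "0 < e"
    then have "\<forall>\<^sub>F i in sequentially. (\<integral>\<^sup>+x. norm (f x - t i x) \<partial>M) < ennreal (e / 3)"
      using lim0 by (intro order_tendstoD(2)[where y = 0]) auto
    then obtain N where N: "\<And>i. N \<le> i \<Longrightarrow> (\<integral>\<^sup>+x. norm (f x - t i x) \<partial>M) < ennreal (e / 3)"
      by (auto simp: eventually_sequentially)
    show "\<exists>N. \<forall>i\<ge>N. \<forall>j\<ge>N. dist (Bochner_Integration.simple_bochner_integral M (t i))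
        (Bochner_Integration.simple_bochner_integral M (t j)) < e"
    proof (intro exI[of _ N] allI impI)
      fix i j assume "N \<le> i" "N \<le> j"
      have "ennreal (dist (Bochner_Integration.simple_bochner_integral M (t i)) (Bochner_Integration.simple_bochner_integral M (t j)))
        \<le> (\<integral>\<^sup>+x. norm (f x - t i x) \<partial>M) + (\<integral>\<^sup>+x. norm (f x - t j x) \<partial>M)"
        unfolding dist_norm by (intro simple_bochner_integral_dist_le M f tint)
      also have "\<dots> \<le> ennreal (e / 3) + ennreal (e / 3)"
        using N \<open>N \<le> i\<close> \<open>N \<le> j\<close> by (intro add_mono less_imp_le)
      also have "\<dots> = ennreal (2 * e / 3)" using \<open>0 < e\<close> by (simp flip: ennreal_plus)
      also have "\<dots> < ennreal e" using \<open>0 < e\<close> by (simp add: ennreal_less_iff)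
      finally show "dist (Bochner_Integration.simple_bochner_integral M (t i)) (Bochner_Integration.simple_bochner_integral M (t j)) < e"
        by (simp add: ennreal_less_iff)
    qed
  qed
  then obtain I where "(\<lambda>i. Bochner_Integration.simple_bochner_integral M (t i)) \<longlonglongrightarrow> I"
    using Cauchy_convergent_iff convergent_def by blast
  then have "has_strong_bochner_integral M f I"
    unfolding has_strong_bochner_integral_def using f tint lim0 by blast
  then show ?thesis using strong_bochner_integral_eq[OF M] by metis
qed

lemma norm_strong_bochner_integral_le:
  fixes f :: "'a \<Rightarrow> 'x::banach"
  assumes M: "complete_measure M" and f: "strongly_measurable M f"
    and fin: "(\<integral>\<^sup>+x. norm (f x) \<partial>M) < \<infinity>"
  shows "ennreal (norm (strong_bochner_integral M f)) \<le> (\<integral>\<^sup>+x. norm (f x) \<partial>M)"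
proof -
  obtain s where s: "\<And>i. Bochner_Integration.simple_bochner_integrable M (s i)"
      "(\<lambda>i. \<integral>\<^sup>+x. norm (f x - s i x) \<partial>M) \<longlonglongrightarrow> 0"
      "(\<lambda>i. Bochner_Integration.simple_bochner_integral M (s i)) \<longlonglongrightarrow> strong_bochner_integral M f"
    using has_strong_bochner_integral_integrable[OF assms] unfolding has_strong_bochner_integral_def by blast
  have z: "Bochner_Integration.simple_bochner_integrable M (\<lambda>_. 0)"
    by (simp add: simple_bochner_integrable.simps)
  have z0: "Bochner_Integration.simple_bochner_integral M (\<lambda>_. 0) = (0 :: 'x)"
    unfolding simple_bochner_integral_def by (rule sum.neutral) auto
  have "ennreal (norm (Bochner_Integration.simple_bochner_integral M (s i)))
      \<le> (\<integral>\<^sup>+x. norm (f x - s i x) \<partial>M) + (\<integral>\<^sup>+x. norm (f x) \<partial>M)" for i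
    using simple_bochner_integral_dist_le[OF M f s(1) z, of i]
    by (simp add: z0)
  moreover have "(\<lambda>i. ennreal (norm (Bochner_Integration.simple_bochner_integral M (s i)))) \<longlonglongrightarrow> ennreal (norm (strong_bochner_integral M f))"
    using s(3) by (intro tendsto_intros)
  moreover have "(\<lambda>i. (\<integral>\<^sup>+x. norm (f x - s i x) \<partial>M) + (\<integral>\<^sup>+x. norm (f x) \<partial>M)) \<longlonglongrightarrow> 0 + (\<integral>\<^sup>+x. norm (f x) \<partial>M)"
    using s(2) by (intro tendsto_intros)
  ultimately show ?thesis
    by (auto intro: LIMSEQ_le)
qed

lemma simple_bochner_integral_sum:
  fixes s :: "nat \<Rightarrow> 'a \<Rightarrow> 'x::real_normed_vector"
  assumes "\<And>l. l < n \<Longrightarrow> Bochner_Integration.simple_bochner_integrable M (s l)"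
  shows "Bochner_Integration.simple_bochner_integrable M (\<lambda>x. \<Sum>l<n. s l x) \<and>
    Bochner_Integration.simple_bochner_integral M (\<lambda>x. \<Sum>l<n. s l x) = (\<Sum>l<n. Bochner_Integration.simple_bochner_integral M (s l))"
  using assms
proof (induction n)
  case 0
  show ?case by (simp add: simple_bochner_integrable.simps
    simple_bochner_integral_def image_constant_conv)
next
  case (Suc n)
  then have "Bochner_Integration.simple_bochner_integrable M (\<lambda>x. \<Sum>l<n. s l x)"
    "Bochner_Integration.simple_bochner_integrable M (s n)" by auto
  with Suc show ?case
    by (auto simp: simple_bochner_integral_add
      intro: simple_bochner_integrable_compose2[of "(+)"])
qed

text \<open>One approximating sequence serves all pieces: cut by the indicator of
  \<open>A l\<close>, it approximates \<open>f\<close> on \<open>A l\<close>. For simple functions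
  the identity is additivity, and both sides pass to the limit.\<close>

lemma strong_bochner_integral_UN:
  fixes f :: "'a \<Rightarrow> 'x::banach" and A :: "nat \<Rightarrow> 'a set"
  assumes M: "complete_measure M" and f: "strongly_measurable M f"
    and fin: "(\<integral>\<^sup>+x. norm (f x) \<partial>M) < \<infinity>"
    and A: "\<And>l. l < n \<Longrightarrow> A l \<in> sets M" "disjoint_family_on A {..<n}" "(\<Union>l<n. A l) = space M"
  shows "strong_bochner_integral M f = (\<Sum>l<n. strong_bochner_integral (restrict_space M (A l)) f)"
proof -
  obtain s where s: "\<And>i. Bochner_Integration.simple_bochner_integrable M (s i)"
      "(\<lambda>i. \<integral>\<^sup>+x. norm (f x - s i x) \<partial>M) \<longlonglongrightarrow> 0"
      "(\<lambda>i. Bochner_Integration.simple_bochner_integral M (s i)) \<longlonglongrightarrow> strong_bochner_integral M f"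
    using has_strong_bochner_integral_integrable[OF M f fin] unfolding has_strong_bochner_integral_def by blast
  have Al: "A l \<inter> space M \<in> sets M" if "l < n" for l using A(1)[OF that] by auto
  have int: "Bochner_Integration.simple_bochner_integrable M (\<lambda>x. indicator (A l) x *\<^sub>R s i x)" if "l < n" for l i
  proof -
    have "simple_function M (\<lambda>x. indicator (A l) x *\<^sub>R s i x)"
      using A(1)[OF that] s(1)[of i]
      by (intro simple_function_compose2[where h = scaleR] simple_function_indicator)
        (auto elim: simple_bochner_integrable.cases)
    moreover have "emeasure M {x \<in> space M. indicator (A l) x *\<^sub>R s i x \<noteq> 0} \<le> emeasure M {x \<in> space M. s i x \<noteq> 0}"
      using s(1)[of i] by (intro emeasure_mono)
       (auto elim!: simple_bochner_integrable.cases dest: measurable_simple_function)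
    ultimately show ?thesis using s(1)[of i]
      by (auto simp: simple_bochner_integrable.simps top_unique)
  qed
  have int_r: "Bochner_Integration.simple_bochner_integrable (restrict_space M (A l)) (s i)" if "l < n" for l i
    unfolding simple_bochner_integrable_restrict_space[OF Al[OF that]] by (rule int[OF that])
  have l: "(\<lambda>i. Bochner_Integration.simple_bochner_integral M (\<lambda>x. indicator (A l) x *\<^sub>R s i x))
      \<longlonglongrightarrow> strong_bochner_integral (restrict_space M (A l)) f" if "l < n" for l
    unfolding simple_bochner_integral_restrict_space[OF Al[OF that] int_r[OF that], symmetric]
  proof (rule has_strong_bochner_integral_tendsto)
    show "complete_measure (restrict_space M (A l))"
      by (intro complete_measure_restrict_space M A that)
    have le: "(\<integral>\<^sup>+x. ennreal (g x) \<partial>restrict_space M (A l)) \<le> (\<integral>\<^sup>+x. ennreal (g x) \<partial>M)" for g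
      unfolding nn_integral_restrict_space[OF Al[OF that]]
      by (intro nn_integral_mono) (auto split: split_indicator)
    then show "has_strong_bochner_integral (restrict_space M (A l)) f (strong_bochner_integral (restrict_space M (A l)) f)"
      using fin that by (intro has_strong_bochner_integral_integrable complete_measure_restrict_space
          strongly_measurable_restrict_space M A f le_less_trans[OF le fin])
    show "(\<lambda>i. \<integral>\<^sup>+x. ennreal (norm (f x - s i x)) \<partial>restrict_space M (A l)) \<longlonglongrightarrow> 0"
      by (rule tendsto_sandwich[OF _ _ tendsto_const s(2)]) (auto intro!: always_eventually le)
  qed (rule int_r[OF that])
  have e: "Bochner_Integration.simple_bochner_integral M (s i) =
      (\<Sum>l<n. Bochner_Integration.simple_bochner_integral M (\<lambda>x. indicator (A l) x *\<^sub>R s i x))" for i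
  proof -
    have si: "s i x = (\<Sum>l<n. indicator (A l) x *\<^sub>R s i x)" if x: "x \<in> space M" for x
    proof -
      obtain l where l: "l < n" "x \<in> A l" using x A(3) by blast
      have "(\<Sum>l<n. indicator (A l) x *\<^sub>R s i x) = (\<Sum>l'<n. if l' = l then s i x else 0)"
        using l A(2) by (intro sum.cong) (auto simp: disjoint_family_on_def split: split_indicator)
      then show ?thesis using l by simp
    qed
    \<comment> \<open>The simple integral sees a function only through its range on the space and
      its level sets there, so agreement on \<open>space M\<close> is enough; outside it the
      indicators vanish.\<close>
    have "s i ` space M = (\<lambda>x. \<Sum>l<n. indicator (A l) x *\<^sub>R s i x) ` space M"
      by (rule image_cong[OF refl si])
    moreover have "{x \<in> space M. s i x = y} = {x \<in> space M. (\<Sum>l<n. indicator (A l) x *\<^sub>R s i x) = y}" for y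
      using si by auto
    ultimately have "Bochner_Integration.simple_bochner_integral M (s i) =
        Bochner_Integration.simple_bochner_integral M (\<lambda>x. \<Sum>l<n. indicator (A l) x *\<^sub>R s i x)"
      unfolding simple_bochner_integral_def
      by simp
    then show ?thesis using simple_bochner_integral_sum[of n M "\<lambda>l x. indicator (A l) x *\<^sub>R s i x"] int by simp
  qed
  have "(\<lambda>i. Bochner_Integration.simple_bochner_integral M (s i)) \<longlonglongrightarrow> (\<Sum>l<n. strong_bochner_integral (restrict_space M (A l)) f)"
    unfolding e using l by (intro tendsto_sum) auto
  then show ?thesis using s(3) LIMSEQ_unique by blast
qed

lemma strong_bochner_integral_const:
  fixes f :: "'a \<Rightarrow> 'x::banach"
  assumes "complete_measure M" "emeasure M (space M) < \<infinity>" "\<And>x. x \<in> space M \<Longrightarrow> f x = a"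
  shows "strong_bochner_integral M f = measure M (space M) *\<^sub>R a"
proof (rule strong_bochner_integral_eq[OF assms(1)])
  have "emeasure M {x \<in> space M. a \<noteq> 0} \<le> emeasure M (space M)" by (intro emeasure_mono) auto
  then have "Bochner_Integration.simple_bochner_integrable M (\<lambda>_. a)"
    using assms(2) by (auto simp: simple_bochner_integrable.simps top_unique)
  moreover have "strongly_measurable M f"
    unfolding strongly_measurable_def using assms(3) by (intro exI[of _ "\<lambda>_ _. a"]) auto
  moreover have "Bochner_Integration.simple_bochner_integral M (\<lambda>_. a) = measure M (space M) *\<^sub>R a"
    by (auto simp: simple_bochner_integral_def image_constant_conv)
  moreover have "(\<integral>\<^sup>+x. norm (f x - a) \<partial>M) = (\<integral>\<^sup>+x. 0 \<partial>M)"
    using assms(3) by (intro nn_integral_cong) auto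
  ultimately show "has_strong_bochner_integral M f (measure M (space M) *\<^sub>R a)"
    unfolding has_strong_bochner_integral_def by (intro conjI exI[of _ "\<lambda>_ _. a"]) auto
qed

subsection \<open>Averages\<close>

lemma complete_measure_lebesgue_on: "A \<in> sets lebesgue \<Longrightarrow> complete_measure (lebesgue_on A)"
  by (intro complete_measure_restrict_space completion.complete_measure_axioms)

lemma lebesgue_on_restrict_space:
  assumes "A \<in> sets lebesgue" "B \<in> sets lebesgue" "B \<subseteq> A"
  shows "restrict_space (lebesgue_on A) B = lebesgue_on B"
  using assms by (subst restrict_restrict_space) (auto simp: Int_absorb1)

lemma sets_lebesgue_on_subset:
  assumes "A \<in> sets lebesgue" "B \<in> sets lebesgue" "B \<subseteq> A"
  shows "B \<in> sets (lebesgue_on A)"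
  using assms by (simp add: sets_restrict_space_iff)

lemma nn_integral_lebesgue_on_subset:
  assumes "A \<in> sets lebesgue" "B \<in> sets lebesgue" "B \<subseteq> A"
  shows "(\<integral>\<^sup>+x. g x \<partial>lebesgue_on B) = (\<integral>\<^sup>+x. g x * indicator B x \<partial>lebesgue_on A)"
  using assms sets_lebesgue_on_subset[OF assms]
  by (subst lebesgue_on_restrict_space[OF assms, symmetric], subst nn_integral_restrict_space) auto

lemma emeasure_space_lebesgue_on:
  "A \<in> lmeasurable \<Longrightarrow> emeasure (lebesgue_on A) (space (lebesgue_on A)) = ennreal (measure lebesgue A)"
  by (simp add: emeasure_restrict_space emeasure_eq_measure2 fmeasurableD)

text \<open>Since \<open>t \<le> 1 + t powr p\<close> and \<open>Q\<close> has finite measure,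
  \<open>L^p\<close> functions have genuine Bochner averages over \<open>Q\<close>.\<close>

lemma nn_integral_norm_less_top:
  fixes f :: "'a::euclidean_space \<Rightarrow> 'x::real_normed_vector"
  assumes Q: "Q \<in> lmeasurable" and "1 < p" and f: "strongly_measurable (lebesgue_on Q) f"
    and fin: "(\<integral>\<^sup>+x. ennreal (norm (f x) powr p) \<partial>lebesgue_on Q) < \<infinity>"
  shows "(\<integral>\<^sup>+x. norm (f x) \<partial>lebesgue_on Q) < \<infinity>"
proof -
  have [measurable]: "(\<lambda>x. norm (f x)) \<in> borel_measurable (lebesgue_on Q)"
    using Q by (intro strongly_measurable_norm complete_measure_lebesgue_on f) auto
  have "t \<le> 1 + t powr p" if "0 \<le> t" for t :: real
  proof (cases "t \<le> 1")
    case False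
    then have "t powr 1 \<le> t powr p" using \<open>1 < p\<close> by (intro powr_mono) auto
    then show ?thesis using False by simp
  qed (use that in \<open>simp add: add_increasing2\<close>)
  then have "(\<integral>\<^sup>+x. norm (f x) \<partial>lebesgue_on Q) \<le> (\<integral>\<^sup>+x. 1 + ennreal (norm (f x) powr p) \<partial>lebesgue_on Q)"
    by (intro nn_integral_mono) (simp flip: ennreal_plus ennreal_1 add: ennreal_leI)
  also have "\<dots> = emeasure (lebesgue_on Q) (space (lebesgue_on Q)) + (\<integral>\<^sup>+x. ennreal (norm (f x) powr p) \<partial>lebesgue_on Q)"
    by (subst nn_integral_add) auto
  also have "\<dots> < \<infinity>" using fin emeasure_space_lebesgue_on[OF Q] by simp
  finally show ?thesis .
qed

text \<open>The tangent-line bound at \<open>a\<close>, the norm of the average, is integrated over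
  \<open>Q\<close>; the integral of the norm is at least \<open>\<mu> * a\<close>.\<close>

lemma average_Jensen:
  fixes f :: "'a::euclidean_space \<Rightarrow> 'x::banach"
  assumes Q: "Q \<in> lmeasurable" "0 < measure lebesgue Q" and "1 < p"
    and f: "strongly_measurable (lebesgue_on Q) f"
    and fin: "(\<integral>\<^sup>+x. ennreal (norm (f x) powr p) \<partial>lebesgue_on Q) < \<infinity>"
  shows "ennreal (measure lebesgue Q * norm (average f Q) powr p) \<le> (\<integral>\<^sup>+x. ennreal (norm (f x) powr p) \<partial>lebesgue_on Q)"
proof -
  have c: "complete_measure (lebesgue_on Q)" using Q by (intro complete_measure_lebesgue_on) auto
  have [measurable]: "(\<lambda>x. norm (f x)) \<in> borel_measurable (lebesgue_on Q)"
    by (rule strongly_measurable_norm[OF c f])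
  define a \<mu> where "a = norm (average f Q)" and "\<mu> = measure lebesgue Q"
  define d where "d = p * a powr (p - 1)"
  have nn: "0 \<le> a" "0 < \<mu>" "0 \<le> d" using Q \<open>1 < p\<close> by (auto simp: a_def \<mu>_def d_def)
  note int1 = nn_integral_norm_less_top[OF Q(1) \<open>1 < p\<close> f fin]
  have E: "emeasure (lebesgue_on Q) (space (lebesgue_on Q)) = ennreal \<mu>"
    using emeasure_space_lebesgue_on[OF Q(1)] by (simp add: \<mu>_def)
  have "\<mu> * a = norm (strong_bochner_integral (lebesgue_on Q) f)"
    using Q by (simp add: a_def \<mu>_def average_def)
  then have J: "ennreal (\<mu> * a) \<le> (\<integral>\<^sup>+x. norm (f x) \<partial>lebesgue_on Q)"
    using norm_strong_bochner_integral_le[OF c f int1] by simp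
  \<comment> \<open>To avoid subtraction among extended nonnegative reals, the negative part
    \<open>d * a\<close> of the tangent is moved to the other side. Its integral
    \<open>\<mu> * d * a\<close> is finite and cancels at the end.\<close>
  have "ennreal (\<mu> * d * a) + ennreal (\<mu> * a powr p) = ennreal (a powr p) * ennreal \<mu> + ennreal d * ennreal (\<mu> * a)"
    using nn by (simp add: ennreal_mult[symmetric] mult_ac flip: ennreal_plus)
  also have "\<dots> \<le> ennreal (a powr p) * ennreal \<mu> + ennreal d * (\<integral>\<^sup>+x. norm (f x) \<partial>lebesgue_on Q)"
    by (intro add_left_mono mult_left_mono J) simp
  also have "\<dots> = (\<integral>\<^sup>+x. ennreal (a powr p) + ennreal d * ennreal (norm (f x)) \<partial>lebesgue_on Q)"
    using E by (subst nn_integral_add) (auto simp: nn_integral_cmult)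
  also have "\<dots> \<le> (\<integral>\<^sup>+x. ennreal (d * a) + ennreal (norm (f x) powr p) \<partial>lebesgue_on Q)"
  proof (rule nn_integral_mono)
    fix x
    have "a powr p + d * (norm (f x) - a) \<le> norm (f x) powr p"
      unfolding d_def using \<open>1 < p\<close> nn by (intro powr_tangent_le) auto
    then show "ennreal (a powr p) + ennreal d * ennreal (norm (f x)) \<le> ennreal (d * a) + ennreal (norm (f x) powr p)"
      using nn by (simp add: ennreal_mult[symmetric] algebra_simps flip: ennreal_plus)
  qed
  also have "\<dots> = ennreal (\<mu> * d * a) + (\<integral>\<^sup>+x. ennreal (norm (f x) powr p) \<partial>lebesgue_on Q)"
    using E nn by (subst nn_integral_add) (auto simp: ennreal_mult[symmetric] mult_ac)
  finally show ?thesis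
    unfolding ennreal_add_left_cancel_le by (simp add: a_def \<mu>_def)
qed

subsection \<open>Trees of sets\<close>

text \<open>The nodes of level \<open>j\<close> are \<open>c j i\<close> with \<open>i < b ^ j\<close>; the children of \<open>c j i\<close> are \<open>c (Suc j) (b * i + l)\<close>
  with \<open>l < b\<close>, so the ancestor \<open>m\<close> levels up of the node with index \<open>i\<close> has index \<open>i div b ^ m\<close>.\<close>

locale set_tree =
  fixes b :: nat and c :: "nat \<Rightarrow> nat \<Rightarrow> 'a::euclidean_space set" and V :: "nat \<Rightarrow> real"
  assumes b_pos: "0 < b"
    and lmeasurable: "c j i \<in> lmeasurable"
    and measure: "measure lebesgue (c j i) = V j"
    and V_pos: "0 < V j"
    and children: "c j i = (\<Union>l<b. c (Suc j) (b * i + l))"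
    and children_disjoint: "disjoint_family_on (\<lambda>l. c (Suc j) (b * i + l)) {..<b}"
begin

lemma sets_lebesgue: "c j i \<in> sets lebesgue"
  using lmeasurable by (rule fmeasurableD)

lemma V_Suc: "V j = real b * V (Suc j)"
proof -
  have "Sigma_Algebra.measure lebesgue (c j 0) = (\<Sum>l<b. Sigma_Algebra.measure lebesgue (c (Suc j) (b * 0 + l)))"
    using fmeasurableD2[OF lmeasurable] unfolding children[of j 0]
    by (intro measure_finite_Union children_disjoint) (auto simp: sets_lebesgue)
  then show ?thesis by (simp add: measure)
qed

lemma subset_parent: "c (Suc j) i \<subseteq> c j (i div b)"
proof -
  have "c (Suc j) (b * (i div b) + i mod b) \<subseteq> c j (i div b)"
    unfolding children[of j]
    using b_pos by (intro UN_upper[of "i mod b" _ "\<lambda>l. c (Suc j) (b * (i div b) + l)"]) simp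
  then show ?thesis by simp
qed

lemma subset_ancestor: "c (j + m) i \<subseteq> c j (i div b ^ m)"
proof (induction m arbitrary: i)
  case (Suc m)
  have "c (j + Suc m) i \<subseteq> c (j + m) (i div b)" using subset_parent[of "j + m"] by simp
  also have "\<dots> \<subseteq> c j (i div b div b ^ m)" by (rule Suc)
  finally show ?case by (simp add: div_mult2_eq)
qed simp

text \<open>Two nodes of one level are separated by their parents or, below a common parent, as
  siblings. The index bounds matter: at level 0 they leave only index 0, while sets
  \<open>c 0 i\<close> with other indices may coincide with the root.\<close>

lemma disjoint: "i < b ^ j \<Longrightarrow> i' < b ^ j \<Longrightarrow> x \<in> c j i \<Longrightarrow> x \<in> c j i' \<Longrightarrow> i = i'"
proof (induction j arbitrary: i i')
  case (Suc j)
  have x: "x \<in> c (Suc j) (b * (i div b) + i mod b)" "x \<in> c (Suc j) (b * (i' div b) + i' mod b)"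
    using Suc.prems by simp_all
  have "x \<in> c j (i div b)" "x \<in> c j (i' div b)" using Suc.prems subset_parent by blast+
  then have e: "i div b = i' div b"
    using Suc.prems b_pos by (intro Suc.IH) (auto simp: less_mult_imp_div_less mult.commute)
  have "i mod b = i' mod b"
    using disjoint_family_onD[OF children_disjoint[of j "i div b"], of "i mod b" "i' mod b"] x b_pos
    unfolding e by auto
  with e show ?case by (metis div_mult_mod_eq)
qed simp

lemma root: "c 0 0 = (\<Union>i<b ^ j. c j i)"
proof (induction j)
  case (Suc j)
  have "(\<Union>i<b ^ j. c j i) = (\<Union>i<b ^ j. \<Union>l<b. c (Suc j) (b * i + l))" 
    by (intro SUP_cong refl children)
  also have "\<dots> = (\<Union>i<b ^ Suc j. c (Suc j) i)"
  proof (intro subset_antisym subsetI)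
    fix x assume "x \<in> (\<Union>i<b ^ j. \<Union>l<b. c (Suc j) (b * i + l))"
    then obtain i l where il: "i < b ^ j" "l < b" "x \<in> c (Suc j) (b * i + l)" by auto
    then have "b * i + l < b * Suc i" by simp
    also have "\<dots> \<le> b ^ Suc j" using il by (simp only: power_Suc) (intro mult_le_mono2, simp)
    finally show "x \<in> (\<Union>i<b ^ Suc j. c (Suc j) i)" using il by auto
  next
    fix x assume "x \<in> (\<Union>i<b ^ Suc j. c (Suc j) i)"
    then obtain i where i: "i < b ^ j * b" "x \<in> c (Suc j) (b * (i div b) + i mod b)" by (auto simp: mult.commute)
    then show "x \<in> (\<Union>i<b ^ j. \<Union>l<b. c (Suc j) (b * i + l))"
      using b_pos by (intro UN_I[of "i div b"] UN_I[of "i mod b"]) (auto simp: less_mult_imp_div_less)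
  qed
  finally show ?case using Suc by simp
qed (auto simp: lessThan_Suc)

lemma subset_root: "i < b ^ j \<Longrightarrow> c j i \<subseteq> c 0 0"
  by (subst root[of j]) (rule UN_upper, simp)

lemma div_power_less: "i < b ^ N \<Longrightarrow> m \<le> N \<Longrightarrow> i div b ^ m < b ^ (N - m)"
  by (rule less_mult_imp_div_less) (simp add: power_add[symmetric])

text \<open>By disjointness, the ancestor of a leaf is the only node of its level through
  \<open>x\<close>. Membership in nodes thus becomes arithmetic on indices.\<close>

lemma node_eq_ancestor:
  assumes "i < b ^ N" "x \<in> c N i" "j \<le> N"
  shows "i' < b ^ j \<and> x \<in> c j i' \<longleftrightarrow> i' = i div b ^ (N - j)"
proof -
  have "i div b ^ (N - j) < b ^ j" "x \<in> c j (i div b ^ (N - j))"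
    using subset_ancestor[of j "N - j" i] div_power_less[of i N "N - j"] assms by auto
  then show ?thesis using disjoint[of i' j "i div b ^ (N - j)" x] by blast
qed

lemma indicator_node:
  assumes "i < b ^ N" "x \<in> c N i" "i' < b ^ N"
  shows "indicator (c N i') x = (if i' = i then 1 else 0)"
  using disjoint[OF assms(3,1) _ assms(2)] assms(2) by (cases "i' = i") (auto simp: indicator_def)

text \<open>On the root such a function is a finite combination of indicators of leaves, each of
  measure \<open>V N\<close>.\<close>

lemma nn_integral_pieces:
  fixes h :: "nat \<Rightarrow> ennreal"
  assumes "\<And>i x. i < b ^ N \<Longrightarrow> x \<in> c N i \<Longrightarrow> g x = h i"
  shows "(\<integral>\<^sup>+x. g x \<partial>lebesgue_on (c 0 0)) = ennreal (V N) * (\<Sum>i<b ^ N. h i)"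
    and "g \<in> borel_measurable (lebesgue_on (c 0 0))"
proof -
  note sub = sets_lebesgue_on_subset[OF sets_lebesgue sets_lebesgue subset_root]
  have g: "g x = (\<Sum>i<b ^ N. h i * indicator (c N i) x)" if x: "x \<in> c 0 0" for x
  proof -
    obtain i where i: "i < b ^ N" "x \<in> c N i" using x root[of N] by blast
    have "(\<Sum>i<b ^ N. h i * indicator (c N i) x) = (\<Sum>i'<b ^ N. if i' = i then h i else 0)"
      by (intro sum.cong) (auto simp: indicator_node[OF i])
    then show ?thesis using assms[OF i] i by simp
  qed
  have "g \<in> borel_measurable (lebesgue_on (c 0 0)) \<longleftrightarrow>
      (\<lambda>x. \<Sum>i<b ^ N. h i * indicator (c N i) x) \<in> borel_measurable (lebesgue_on (c 0 0))"
    by (rule measurable_cong) (simp add: g)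
  also have \<dots> using sub by (intro borel_measurable_sum borel_measurable_times_ennreal borel_measurable_indicator) auto
  finally show "g \<in> borel_measurable (lebesgue_on (c 0 0))" .
  have "(\<integral>\<^sup>+x. g x \<partial>lebesgue_on (c 0 0)) = (\<integral>\<^sup>+x. (\<Sum>i<b ^ N. h i * indicator (c N i) x) \<partial>lebesgue_on (c 0 0))"
    by (rule nn_integral_cong) (simp add: g)
  also have "\<dots> = (\<Sum>i<b ^ N. h i * emeasure (lebesgue_on (c 0 0)) (c N i))"
    using sub by (subst nn_integral_sum) (auto intro!: sum.cong nn_integral_cmult_indicator)
  also have "\<dots> = (\<Sum>i<b ^ N. h i * ennreal (V N))"
    using subset_root lmeasurable sets_lebesgue
    by (intro sum.cong) (auto simp: emeasure_restrict_space emeasure_eq_measure2 measure)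
  finally show "(\<integral>\<^sup>+x. g x \<partial>lebesgue_on (c 0 0)) = ennreal (V N) * (\<Sum>i<b ^ N. h i)"
    by (simp add: sum_distrib_left mult.commute)
qed

text \<open>The integral is additive over the \<open>b\<close> children, and their equal volumes
  make the parent's average an unweighted mean.\<close>

lemma average_children:
  fixes f :: "'a \<Rightarrow> 'x::banach"
  assumes f: "strongly_measurable (lebesgue_on (c 0 0)) f" "(\<integral>\<^sup>+x. norm (f x) \<partial>lebesgue_on (c 0 0)) < \<infinity>"
    and i: "i < b ^ j"
  shows "average f (c j i) = block_mean b (\<lambda>i. average f (c (Suc j) i)) i"
proof -
  let ?Q = "c j i" and ?A = "\<lambda>l. c (Suc j) (b * i + l)"
  have sub: "?A l \<subseteq> ?Q" if "l < b" for l unfolding children[of j i] using that by auto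
  have "strong_bochner_integral (lebesgue_on ?Q) f = (\<Sum>l<b. strong_bochner_integral (restrict_space (lebesgue_on ?Q) (?A l)) f)"
  proof (rule strong_bochner_integral_UN)
    show "complete_measure (lebesgue_on ?Q)" by (rule complete_measure_lebesgue_on[OF sets_lebesgue])
    show "strongly_measurable (lebesgue_on ?Q) f"
      using strongly_measurable_restrict_space[OF f(1) sets_lebesgue_on_subset[OF sets_lebesgue sets_lebesgue subset_root[OF i]]]
      by (simp add: lebesgue_on_restrict_space[OF sets_lebesgue sets_lebesgue subset_root[OF i]])
    have "(\<integral>\<^sup>+x. norm (f x) \<partial>lebesgue_on ?Q) \<le> (\<integral>\<^sup>+x. norm (f x) \<partial>lebesgue_on (c 0 0))"
      unfolding nn_integral_lebesgue_on_subset[OF sets_lebesgue sets_lebesgue subset_root[OF i]]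
      by (intro nn_integral_mono) (auto split: split_indicator)
    then show "(\<integral>\<^sup>+x. norm (f x) \<partial>lebesgue_on ?Q) < \<infinity>" using f(2) by (rule le_less_trans)
    show "?A l \<in> sets (lebesgue_on ?Q)" if "l < b" for l
      by (intro sets_lebesgue_on_subset sets_lebesgue sub that)
  qed (use children[of j i] children_disjoint in auto)
  also have "\<dots> = (\<Sum>l<b. strong_bochner_integral (lebesgue_on (?A l)) f)"
    by (intro sum.cong) (auto simp: lebesgue_on_restrict_space[OF sets_lebesgue sets_lebesgue sub])
  finally have "average f ?Q = (1 / V j) *\<^sub>R (\<Sum>l<b. strong_bochner_integral (lebesgue_on (?A l)) f)"
    by (simp add: average_def measure)
  also have "\<dots> = block_mean b (\<lambda>i. average f (c (Suc j) i)) i"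
    by (simp add: block_mean_def average_def measure V_Suc[of j] scaleR_sum_right)
  finally show ?thesis .
qed

text \<open>Iterating the one-level identity shows that, down to a given level, the averages depend
  on \<open>f\<close> only through its averages at that level.\<close>

lemma average_descendants:
  fixes f :: "'a \<Rightarrow> 'x::banach"
  assumes f: "strongly_measurable (lebesgue_on (c 0 0)) f" "(\<integral>\<^sup>+x. norm (f x) \<partial>lebesgue_on (c 0 0)) < \<infinity>"
    and i: "i < b ^ j"
  shows "average f (c j i) = block_mean (b ^ m) (\<lambda>i. average f (c (j + m) i)) i"
  using i
proof (induction m arbitrary: j i)
  case 0
  show ?case by (simp add: block_mean_1)
next
  case (Suc m)
  have lt: "b * i + l < b ^ Suc j" if "l < b" for l
  proof -
    have "b * i + l < b * Suc i" using that by simp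
    also have "\<dots> \<le> b ^ Suc j" using Suc.prems by (simp only: power_Suc) (intro mult_le_mono2, simp)
    finally show ?thesis .
  qed
  have "average f (c j i) = block_mean b (\<lambda>i. average f (c (Suc j) i)) i"
    by (rule average_children[OF f Suc.prems])
  also have "\<dots> = block_mean b (block_mean (b ^ m) (\<lambda>i. average f (c (Suc j + m) i))) i"
    unfolding block_mean_def[of b] using Suc.IH lt by simp
  also have "\<dots> = block_mean (b ^ Suc m) (\<lambda>i. average f (c (j + Suc m) i)) i"
    by (simp add: block_mean_block_mean mult.commute)
  finally show ?case .
qed

section \<open>The maximal operator on a single tree\<close>

definition local_averages :: "('a \<Rightarrow> 'x::banach) \<Rightarrow> nat \<Rightarrow> 'a \<Rightarrow> 'x set" where
  "local_averages f N x = {average f (c j i) | j i. j \<le> N \<and> i < b ^ j \<and> x \<in> c j i}"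

text \<open>The node of level \<open>j\<close> through \<open>x\<close> is the ancestor
  \<open>m = N - j\<close> levels up. So the set is the one in \<open>tree_bounded\<close> for the
  leaf averages, the same for all \<open>x\<close> in the leaf.\<close>

lemma local_averages_eq:
  fixes f :: "'a \<Rightarrow> 'x::banach"
  assumes f: "strongly_measurable (lebesgue_on (c 0 0)) f" "(\<integral>\<^sup>+x. norm (f x) \<partial>lebesgue_on (c 0 0)) < \<infinity>"
    and i: "i < b ^ N" "x \<in> c N i"
  shows "local_averages f N x = {block_mean (b ^ m) (\<lambda>i. average f (c N i)) (i div b ^ m) | m. m \<le> N}"
proof -
  have e: "average f (c (N - m) (i div b ^ m)) = block_mean (b ^ m) (\<lambda>i. average f (c N i)) (i div b ^ m)"
    if "m \<le> N" for m
    using average_descendants[OF f div_power_less[OF i(1) that], of m] that by simp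
  have "local_averages f N x = {average f (c j (i div b ^ (N - j))) | j. j \<le> N}"
    unfolding local_averages_def by (simp add: node_eq_ancestor[OF i] cong: conj_cong)
  also have "\<dots> = {average f (c (N - m) (i div b ^ m)) | m. m \<le> N}"
  proof safe
    fix j assume "j \<le> N"
    then show "\<exists>m. average f (c j (i div b ^ (N - j))) = average f (c (N - m) (i div b ^ m)) \<and> m \<le> N"
      by (intro exI[of _ "N - j"]) simp
  next
    fix m assume "m \<le> N"
    then show "\<exists>j. average f (c (N - m) (i div b ^ m)) = average f (c j (i div b ^ (N - j))) \<and> j \<le> N"
      by (intro exI[of _ "N - m"]) simp
  qed
  also have "\<dots> = {block_mean (b ^ m) (\<lambda>i. average f (c N i)) (i div b ^ m) | m. m \<le> N}"
    by (intro Collect_cong ex_cong1) (auto simp: e)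
  finally show ?thesis .
qed

lemma local_maximal_integral:
  fixes f :: "'a \<Rightarrow> 'x::banach" and smul :: "'k::real_normed_field \<Rightarrow> 'x \<Rightarrow> 'x"
  assumes f: "strongly_measurable (lebesgue_on (c 0 0)) f" "(\<integral>\<^sup>+x. norm (f x) \<partial>lebesgue_on (c 0 0)) < \<infinity>"
  shows "(\<integral>\<^sup>+x. ennreal_powr (R_bound smul (local_averages f N x)) p \<partial>lebesgue_on (c 0 0)) =
      ennreal (V N) * (\<Sum>i<b ^ N. ennreal_powr
        (R_bound smul {block_mean (b ^ m) (\<lambda>i. average f (c N i)) (i div b ^ m) | m. m \<le> N}) p)"
    and "(\<lambda>x. ennreal_powr (R_bound smul (local_averages f N x)) p) \<in> borel_measurable (lebesgue_on (c 0 0))"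
proof -
  have e: "ennreal_powr (R_bound smul (local_averages f N x)) p = ennreal_powr
      (R_bound smul {block_mean (b ^ m) (\<lambda>i. average f (c N i)) (i div b ^ m) | m. m \<le> N}) p"
    if "i < b ^ N" "x \<in> c N i" for i x
    using local_averages_eq[OF f that] by simp
  from nn_integral_pieces(1)[OF e]
  show "(\<integral>\<^sup>+x. ennreal_powr (R_bound smul (local_averages f N x)) p \<partial>lebesgue_on (c 0 0)) =
      ennreal (V N) * (\<Sum>i<b ^ N. ennreal_powr
        (R_bound smul {block_mean (b ^ m) (\<lambda>i. average f (c N i)) (i div b ^ m) | m. m \<le> N}) p)" .
  from nn_integral_pieces(2)[OF e]
  show "(\<lambda>x. ennreal_powr (R_bound smul (local_averages f N x)) p) \<in> borel_measurable (lebesgue_on (c 0 0))" .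
qed

lemma local_maximal_bound:
  fixes f :: "'a \<Rightarrow> 'x::banach" and smul :: "'k::real_normed_field \<Rightarrow> 'x \<Rightarrow> 'x"
  assumes "1 < p"
    and C: "\<And>N (f :: nat \<Rightarrow> 'x). (\<Sum>i<b ^ N. ennreal_powr (R_bound smul {block_mean (b ^ m) f (i div b ^ m) | m. m \<le> N}) p)
       \<le> ennreal C * (\<Sum>i<b ^ N. ennreal (norm (f i) powr p))"
    and f: "strongly_measurable (lebesgue_on (c 0 0)) f"
    and fin: "(\<integral>\<^sup>+x. ennreal (norm (f x) powr p) \<partial>lebesgue_on (c 0 0)) < \<infinity>"
  shows "(\<integral>\<^sup>+x. ennreal_powr (R_bound smul (local_averages f N x)) p \<partial>lebesgue_on (c 0 0))
    \<le> ennreal C * (\<integral>\<^sup>+x. ennreal (norm (f x) powr p) \<partial>lebesgue_on (c 0 0))"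
proof -
  let ?M = "lebesgue_on (c 0 0)" and ?a = "\<lambda>i. average f (c N i)"
  note sub = sets_lebesgue_on_subset[OF sets_lebesgue sets_lebesgue subset_root]
  note fin1 = nn_integral_norm_less_top[OF lmeasurable \<open>1 < p\<close> f fin]
  have [measurable]: "(\<lambda>x. norm (f x)) \<in> borel_measurable ?M"
    by (intro strongly_measurable_norm complete_measure_lebesgue_on sets_lebesgue f)
  have J: "ennreal (V N) * ennreal (norm (?a i) powr p) \<le> (\<integral>\<^sup>+x. ennreal (norm (f x) powr p) * indicator (c N i) x \<partial>?M)"
    if i: "i < b ^ N" for i
  proof -
    note r = nn_integral_lebesgue_on_subset[OF sets_lebesgue sets_lebesgue subset_root[OF i]]
    have "ennreal (measure lebesgue (c N i) * norm (?a i) powr p) \<le> (\<integral>\<^sup>+x. ennreal (norm (f x) powr p) \<partial>lebesgue_on (c N i))"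
    proof (rule average_Jensen[OF lmeasurable _ \<open>1 < p\<close>])
      show "strongly_measurable (lebesgue_on (c N i)) f"
        using strongly_measurable_restrict_space[OF f sub[OF i]]
        by (simp add: lebesgue_on_restrict_space[OF sets_lebesgue sets_lebesgue subset_root[OF i]])
      have "(\<integral>\<^sup>+x. ennreal (norm (f x) powr p) \<partial>lebesgue_on (c N i)) \<le> (\<integral>\<^sup>+x. ennreal (norm (f x) powr p) \<partial>?M)"
        unfolding r by (intro nn_integral_mono) (auto split: split_indicator)
      then show "(\<integral>\<^sup>+x. ennreal (norm (f x) powr p) \<partial>lebesgue_on (c N i)) < \<infinity>" using fin by (rule le_less_trans)
    qed (simp add: measure V_pos)
    then show ?thesis unfolding r using V_pos[of N] by (simp add: measure ennreal_mult less_imp_le)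
  qed
  have "(\<integral>\<^sup>+x. ennreal_powr (R_bound smul (local_averages f N x)) p \<partial>?M)
      \<le> ennreal (V N) * (ennreal C * (\<Sum>i<b ^ N. ennreal (norm (?a i) powr p)))"
    unfolding local_maximal_integral(1)[OF f fin1] by (intro mult_left_mono C) simp
  also have "\<dots> = ennreal C * (\<Sum>i<b ^ N. ennreal (V N) * ennreal (norm (?a i) powr p))"
    by (simp add: sum_distrib_left[symmetric] mult.left_commute del: sum_ennreal)
  also have "\<dots> \<le> ennreal C * (\<Sum>i<b ^ N. \<integral>\<^sup>+x. ennreal (norm (f x) powr p) * indicator (c N i) x \<partial>?M)"
    by (intro mult_left_mono sum_mono J) auto
  also have "(\<Sum>i<b ^ N. \<integral>\<^sup>+x. ennreal (norm (f x) powr p) * indicator (c N i) x \<partial>?M) =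
      (\<integral>\<^sup>+x. (\<Sum>i<b ^ N. ennreal (norm (f x) powr p) * indicator (c N i) x) \<partial>?M)"
    using sub by (subst nn_integral_sum) auto
  also have "\<dots> = (\<integral>\<^sup>+x. ennreal (norm (f x) powr p) \<partial>?M)"
  proof (rule nn_integral_cong)
    fix x assume "x \<in> space ?M"
    then have "x \<in> c 0 0" by simp
    then obtain i where i: "i < b ^ N" "x \<in> c N i" using root[of N] by blast
    have "(\<Sum>i<b ^ N. ennreal (norm (f x) powr p) * indicator (c N i) x) =
        (\<Sum>i'<b ^ N. if i' = i then ennreal (norm (f x) powr p) else 0)"
      by (intro sum.cong) (auto simp: indicator_node[OF i])
    then show "(\<Sum>i<b ^ N. ennreal (norm (f x) powr p) * indicator (c N i) x) = ennreal (norm (f x) powr p)"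
      using i by simp
  qed
  finally show ?thesis .
qed

text \<open>Leaf values \<open>a\<close> are realized by a step function that vanishes outside the
  root and whose averages are the block means of \<open>a\<close>. Further sets in \<open>D\<close>
  only increase the operator. The leaf measure \<open>V N\<close> occurs on both sides, so the
  constant is inherited unchanged.\<close>

lemma tree_bounded_of_Lp_bounded:
  fixes smul :: "'k::real_normed_field \<Rightarrow> 'x::banach \<Rightarrow> 'x"
  assumes "1 < p" and \<Omega>: "\<Omega> \<in> sets lebesgue" "c 0 0 \<subseteq> \<Omega>"
    and D: "\<And>j i. i < b ^ j \<Longrightarrow> c j i \<in> D"
    and "Lp_bounded p (lebesgue_on \<Omega>) (rademacher_maximal smul D)"
  shows "tree_bounded smul p b"
proof -
  obtain C where C: "0 \<le> C" "\<And>f. in_Lp p (lebesgue_on \<Omega>) f \<Longrightarrow>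
    (\<integral>\<^sup>+x. ennreal_powr (rademacher_maximal smul D f x) p \<partial>lebesgue_on \<Omega>)
      \<le> ennreal C * (\<integral>\<^sup>+x. ennreal (norm (f x) powr p) \<partial>lebesgue_on \<Omega>)"
    using assms(1,5) by (auto simp: Lp_bounded_iff)
  show ?thesis
    unfolding tree_bounded_def
  proof (intro exI[of _ C] conjI allI C(1))
    fix N and a :: "nat \<Rightarrow> 'x"
    define F where "F x = (\<Sum>i<b ^ N. indicator (c N i) x *\<^sub>R a i)" for x
    have F: "F x = a i" if i: "i < b ^ N" "x \<in> c N i" for i x
    proof -
      have "F x = (\<Sum>i'<b ^ N. if i' = i then a i else 0)"
        unfolding F_def by (intro sum.cong) (auto simp: indicator_node[OF i])
      then show ?thesis using i by simp
    qed
    have F0: "F x = 0" if "x \<notin> c 0 0" for x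
      unfolding F_def using that root[of N] by (intro sum.neutral) auto
    have simple: "simple_function (lebesgue_on A) F" if "A \<in> sets lebesgue" for A
      unfolding F_def
    proof (intro simple_function_sum simple_function_compose2[where h = scaleR] simple_function_const)
      show "simple_function (lebesgue_on A) (indicator (c N i) :: _ \<Rightarrow> real)" for i
        using that sets_lebesgue[of N i]
        by (subst simple_function_restrict_space) (auto intro!: simple_function_compose2[where h = "(*)"] simple_function_indicator)
    qed
    then have sm: "strongly_measurable (lebesgue_on A) F" if "A \<in> sets lebesgue" for A
      unfolding strongly_measurable_def using that by (intro exI[of _ "\<lambda>_. F"]) auto
    have ind: "(\<integral>\<^sup>+x. g x \<partial>lebesgue_on (c 0 0)) \<le> (\<integral>\<^sup>+x. h x \<partial>lebesgue_on \<Omega>)"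
      if "\<And>x. x \<in> c 0 0 \<Longrightarrow> g x \<le> h x" for g h
      unfolding nn_integral_lebesgue_on_subset[OF \<Omega>(1) sets_lebesgue \<Omega>(2)] using that
      by (intro nn_integral_mono) (auto split: split_indicator)
    have nF: "(\<integral>\<^sup>+x. ennreal (norm (F x) powr p) \<partial>lebesgue_on (c 0 0)) = ennreal (V N) * (\<Sum>i<b ^ N. ennreal (norm (a i) powr p))"
      by (rule nn_integral_pieces) (simp add: F)
    have "(\<integral>\<^sup>+x. ennreal (norm (F x) powr p) \<partial>lebesgue_on (c 0 0)) = (\<integral>\<^sup>+x. ennreal (norm (F x) powr p) \<partial>lebesgue_on \<Omega>)"
      unfolding nn_integral_lebesgue_on_subset[OF \<Omega>(1) sets_lebesgue \<Omega>(2)]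
      using F0 by (intro nn_integral_cong) (auto split: split_indicator)
    note n\<Omega> = this[unfolded nF, symmetric]
    have fin: "ennreal (V N) * (\<Sum>i<b ^ N. ennreal (norm (a i) powr p)) < \<infinity>"
      by (simp add: sum_ennreal ennreal_mult_less_top)
    have inLp: "in_Lp p (lebesgue_on \<Omega>) F"
      using assms(1) fin sm[OF \<Omega>(1)] by (simp add: in_Lp_iff n\<Omega>)
    note sm0 = sm[OF sets_lebesgue[of 0 0]]
    have fin1: "(\<integral>\<^sup>+x. norm (F x) \<partial>lebesgue_on (c 0 0)) < \<infinity>"
      using fin by (intro nn_integral_norm_less_top[OF lmeasurable assms(1) sm0]) (simp add: nF)
    have av: "average F (c N i) = a i" if i: "i < b ^ N" for i
    proof -
      have "strong_bochner_integral (lebesgue_on (c N i)) F = Sigma_Algebra.measure (lebesgue_on (c N i)) (space (lebesgue_on (c N i))) *\<^sub>R a i"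
        using F[OF i] emeasure_space_lebesgue_on[OF lmeasurable[of N i]]
        by (intro strong_bochner_integral_const complete_measure_lebesgue_on sets_lebesgue) auto
      then show ?thesis
        using sets_lebesgue[of N i] V_pos[of N] by (simp add: average_def measure_restrict_space measure)
    qed
    have set: "{block_mean (b ^ m) (\<lambda>i. average F (c N i)) (i div b ^ m) | m. m \<le> N} =
        {block_mean (b ^ m) a (i div b ^ m) | m. m \<le> N}" if i: "i < b ^ N" for i
    proof -
      have "block_mean (b ^ m) (\<lambda>i. average F (c N i)) (i div b ^ m) = block_mean (b ^ m) a (i div b ^ m)" if "m \<le> N" for m
      proof -
        have "b ^ m * (i div b ^ m) + l < b ^ N" if "l < b ^ m" for l
        proof -
          have "b ^ m * (i div b ^ m) + l < b ^ m * Suc (i div b ^ m)" using that by simp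
          also have "\<dots> \<le> b ^ m * b ^ (N - m)"
            using div_power_less[OF i \<open>m \<le> N\<close>] by (intro mult_le_mono2) simp
          finally show ?thesis using \<open>m \<le> N\<close> by (simp flip: power_add)
        qed
        then show ?thesis by (simp add: block_mean_def av)
      qed
      then show ?thesis by force
    qed
    have "ennreal (V N) * (\<Sum>i<b ^ N. ennreal_powr (R_bound smul {block_mean (b ^ m) a (i div b ^ m) | m. m \<le> N}) p)
        = (\<integral>\<^sup>+x. ennreal_powr (R_bound smul (local_averages F N x)) p \<partial>lebesgue_on (c 0 0))"
      unfolding local_maximal_integral(1)[OF sm0 fin1] using set by simp
    also have "\<dots> \<le> (\<integral>\<^sup>+x. ennreal_powr (rademacher_maximal smul D F x) p \<partial>lebesgue_on \<Omega>)"
      unfolding rademacher_maximal_def local_averages_def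
      using assms(1) D by (intro ind ennreal_powr_mono R_bound_mono) auto
    also have "\<dots> \<le> ennreal C * (ennreal (V N) * (\<Sum>i<b ^ N. ennreal (norm (a i) powr p)))"
      using C(2)[OF inLp] by (simp only: n\<Omega>)
    also have "\<dots> = ennreal (V N) * (ennreal C * (\<Sum>i<b ^ N. ennreal (norm (a i) powr p)))"
      by (simp add: mult.left_commute del: sum_ennreal)
    finally show "(\<Sum>i<b ^ N. ennreal_powr (R_bound smul {block_mean (b ^ m) a (i div b ^ m) | m. m \<le> N}) p)
        \<le> ennreal C * (\<Sum>i<b ^ N. ennreal (norm (a i) powr p))"
      using V_pos[of N] by (subst (asm) ennreal_mult_le_mult_iff) auto
  qed
qed

end

subsection \<open>Dyadic cubes\<close>

definition dyadic_cube :: "(int \<Rightarrow> 'a::euclidean_space) \<Rightarrow> int \<Rightarrow> 'a \<Rightarrow> 'a set" where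
  "dyadic_cube \<beta> k m = (\<lambda>x. (2 powi (-k)) *\<^sub>R (x + m) + dyadic_shift \<beta> k) ` half_open_unit_cube"

lemma dyadic_level_eq: "dyadic_level \<beta> k = dyadic_cube \<beta> k ` integer_points"
  by (auto simp: dyadic_level_def dyadic_cube_def)

text \<open>The tail of the series loses one term per level. Summability, by comparison with a
  geometric series, has to be shown because an infinite sum that does not converge is 0 by
  convention.\<close>

lemma dyadic_shift_rec:
  fixes \<beta> :: "int \<Rightarrow> 'a::euclidean_space"
  assumes "dyadic_parameter \<beta>"
  shows "dyadic_shift \<beta> k = (2 powi (-(k + 1))) *\<^sub>R \<beta> (k + 1) + dyadic_shift \<beta> (k + 1)"
proof -
  have bound: "norm (\<beta> j) \<le> real DIM('a)" for j
  proof -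
    have "norm (\<beta> j) \<le> (\<Sum>b\<in>Basis. \<bar>\<beta> j \<bullet> b\<bar>)" by (rule norm_le_l1)
    also have "\<dots> \<le> (\<Sum>b\<in>(Basis :: 'a set). 1)"
    proof (rule sum_mono)
      fix b :: 'a assume "b \<in> Basis"
      then have "\<beta> j \<bullet> b \<in> {0, 1}" using assms unfolding dyadic_parameter_def by blast
      then show "\<bar>\<beta> j \<bullet> b\<bar> \<le> 1" by auto
    qed
    finally show ?thesis by simp
  qed
  have bij: "bij_betw (\<lambda>n. k + 2 + int n) UNIV {k + 1<..}"
    by (rule bij_betw_byWitness[where f' = "\<lambda>j. nat (j - (k + 2))"]) auto
  have "(\<lambda>n. (2 powi (-(k + 2 + int n))) *\<^sub>R \<beta> (k + 2 + int n)) summable_on UNIV"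
  proof (rule norm_summable_imp_summable_on)
    have e: "(2::real) powi (-(k + 2 + int n)) = 2 powi (-(k + 2)) * (1 / 2) ^ n" for n
      by (simp add: power_int_add power_int_minus power_one_over field_simps power_int_diff)
    have "summable (\<lambda>n. 2 powi (-(k + 2)) * real DIM('a) * (1 / 2 :: real) ^ n)"
      by (intro summable_mult summable_geometric) simp
    then show "summable (\<lambda>n. norm ((2 powi (-(k + 2 + int n))) *\<^sub>R \<beta> (k + 2 + int n)))"
    proof (rule summable_comparison_test'[where N = 0])
      fix n :: nat
      show "norm (norm ((2 powi (-(k + 2 + int n))) *\<^sub>R \<beta> (k + 2 + int n))) \<le> 2 powi (-(k + 2)) * real DIM('a) * (1 / 2) ^ n"
        unfolding e using bound[of "k + 2 + int n"] by (simp add: mult_ac mult_left_mono)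
    qed
  qed
  then have "(\<lambda>j. (2 powi (-j)) *\<^sub>R \<beta> j) summable_on {k + 1<..}"
    using summable_on_reindex_bij_betw[OF bij, of "\<lambda>j. (2 powi (-j)) *\<^sub>R \<beta> j"] by simp
  moreover have "{k<..} = insert (k + 1) {k + 1<..}" by auto
  ultimately show ?thesis
    unfolding dyadic_shift_def by (simp add: infsum_insert)
qed

text \<open>The inverse of the affine map in \<open>dyadic_cube\<close>. In this coordinate the
  cubes of level \<open>k\<close> are unit cells with integer corners, and the index of the cube
  through \<open>x\<close> is the componentwise floor.\<close>

definition dyadic_coord :: "(int \<Rightarrow> 'a::euclidean_space) \<Rightarrow> int \<Rightarrow> 'a \<Rightarrow> 'a" where
  "dyadic_coord \<beta> k x = (2 powi k) *\<^sub>R (x - dyadic_shift \<beta> k)"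

lemma mem_dyadic_cube:
  "x \<in> dyadic_cube \<beta> k m \<longleftrightarrow> (\<forall>b\<in>Basis. m \<bullet> b \<le> dyadic_coord \<beta> k x \<bullet> b \<and> dyadic_coord \<beta> k x \<bullet> b < m \<bullet> b + 1)"
proof -
  have "x \<in> dyadic_cube \<beta> k m \<longleftrightarrow> dyadic_coord \<beta> k x - m \<in> half_open_unit_cube"
  proof
    assume "dyadic_coord \<beta> k x - m \<in> half_open_unit_cube"
    moreover have "x = (2 powi (-k)) *\<^sub>R ((dyadic_coord \<beta> k x - m) + m) + dyadic_shift \<beta> k"
      by (simp add: dyadic_coord_def power_int_minus)
    ultimately show "x \<in> dyadic_cube \<beta> k m" unfolding dyadic_cube_def by (rule rev_image_eqI)
  qed (auto simp: dyadic_cube_def dyadic_coord_def power_int_minus)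
  then show ?thesis by (auto simp: half_open_unit_cube_def inner_diff_left algebra_simps)
qed

lemma dyadic_cube_eq_interval:
  "dyadic_cube \<beta> k m = {x. \<forall>b\<in>Basis. (dyadic_shift \<beta> k + (2 powi (-k)) *\<^sub>R m) \<bullet> b \<le> x \<bullet> b \<and>
    x \<bullet> b < (dyadic_shift \<beta> k + (2 powi (-k)) *\<^sub>R (m + One)) \<bullet> b}"
proof -
  have pos: "(0::real) < 2 powi k" by simp
  show ?thesis
    unfolding set_eq_iff mem_dyadic_cube dyadic_coord_def mem_Collect_eq
    by (intro allI ball_cong refl arg_cong2[where f = "(\<and>)"])
      (use pos in \<open>simp_all add: inner_add_left inner_diff_left power_int_minus field_simps\<close>)
qed

text \<open>The half-open cube differs from the closed box by part of its boundary, a null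
  set.\<close>

lemma dyadic_cube_measure:
  fixes m :: "'a::euclidean_space"
  shows "dyadic_cube \<beta> k m \<in> lmeasurable"
    and "measure lebesgue (dyadic_cube \<beta> k m) = (2 powi (-k)) ^ DIM('a)"
proof -
  define lo hi where "lo = dyadic_shift \<beta> k + (2 powi (-k)) *\<^sub>R m"
    and "hi = dyadic_shift \<beta> k + (2 powi (-k)) *\<^sub>R (m + One)"
  have cube: "dyadic_cube \<beta> k m = {x. \<forall>b\<in>Basis. lo \<bullet> b \<le> x \<bullet> b \<and> x \<bullet> b < hi \<bullet> b}"
    unfolding dyadic_cube_eq_interval lo_def hi_def ..
  have "cbox lo hi - dyadic_cube \<beta> k m \<union> (dyadic_cube \<beta> k m - cbox lo hi) \<subseteq> cbox lo hi - box lo hi"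
    unfolding cube by (auto simp: mem_box less_imp_le)
  then have neg: "negligible (cbox lo hi - dyadic_cube \<beta> k m \<union> (dyadic_cube \<beta> k m - cbox lo hi))"
    by (rule negligible_subset[OF negligible_frontier_interval])
  show "dyadic_cube \<beta> k m \<in> lmeasurable"
    by (rule lmeasurable_negligible_symdiff[OF lmeasurable_cbox neg])
  have d: "hi \<bullet> b - lo \<bullet> b = 2 powi (-k)" if "b \<in> Basis" for b
    using that by (simp add: lo_def hi_def inner_add_left algebra_simps)
  have "measure lebesgue (dyadic_cube \<beta> k m) = measure lebesgue (cbox lo hi)"
    by (rule measure_negligible_symdiff[OF lmeasurable_cbox neg])
  also have "\<dots> = measure lborel (cbox lo hi)" by simp
  also have "\<dots> = (\<Prod>b\<in>Basis. hi \<bullet> b - lo \<bullet> b)"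
  proof (intro content_cbox ballI)
    fix b :: 'a assume "b \<in> Basis"
    then show "lo \<bullet> b \<le> hi \<bullet> b" using d[of b] by (smt (verit) zero_le_power_int)
  qed
  also have "\<dots> = (2 powi (-k)) ^ DIM('a)" by (simp add: d)
  finally show "measure lebesgue (dyadic_cube \<beta> k m) = (2 powi (-k)) ^ DIM('a)" .
qed

lemma dyadic_cube_unique:
  assumes "m \<in> integer_points" "m' \<in> integer_points" "x \<in> dyadic_cube \<beta> k m" "x \<in> dyadic_cube \<beta> k m'"
  shows "m = m'"
proof (rule euclidean_eqI)
  fix b :: 'a assume b: "b \<in> Basis"
  then have "m \<bullet> b \<in> \<int>" "m' \<bullet> b \<in> \<int>" using assms(1,2) by (auto simp: integer_points_def)
  then obtain i j where "m \<bullet> b = of_int i" "m' \<bullet> b = of_int j" by (elim Ints_cases)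
  moreover have "\<lfloor>dyadic_coord \<beta> k x \<bullet> b\<rfloor> = i" "\<lfloor>dyadic_coord \<beta> k x \<bullet> b\<rfloor> = j"
    using assms(3,4) b calculation by (auto simp: mem_dyadic_cube floor_eq_iff)
  ultimately show "m \<bullet> b = m' \<bullet> b" by simp
qed

lemma dyadic_cube_cover: "\<exists>m\<in>integer_points. x \<in> dyadic_cube \<beta> k m"
proof
  let ?m = "\<Sum>b\<in>Basis. of_int \<lfloor>dyadic_coord \<beta> k x \<bullet> b\<rfloor> *\<^sub>R b"
  have m: "?m \<bullet> b = of_int \<lfloor>dyadic_coord \<beta> k x \<bullet> b\<rfloor>" if "b \<in> Basis" for b using that by simp
  show "?m \<in> integer_points" unfolding integer_points_def using m by simp
  show "x \<in> dyadic_cube \<beta> k ?m" unfolding mem_dyadic_cube using m by simp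
qed

lemma countable_integer_points: "countable (integer_points :: 'a::euclidean_space set)"
proof (rule countable_subset)
  show "integer_points \<subseteq> (\<lambda>g. \<Sum>b\<in>Basis. of_int (g b) *\<^sub>R b) ` (PiE (Basis :: 'a set) (\<lambda>_. UNIV :: int set))"
  proof
    fix m :: 'a assume m: "m \<in> integer_points"
    have "m = (\<Sum>b\<in>Basis. of_int \<lfloor>m \<bullet> b\<rfloor> *\<^sub>R b)"
      using m by (subst euclidean_representation[symmetric])
        (intro sum.cong refl arg_cong2[where f = scaleR]; auto simp: integer_points_def elim!: Ints_cases)
    also have "\<dots> = (\<Sum>b\<in>Basis. of_int (restrict (\<lambda>b. \<lfloor>m \<bullet> b\<rfloor>) Basis b) *\<^sub>R b)" by simp
    finally show "m \<in> (\<lambda>g. \<Sum>b\<in>Basis. of_int (g b) *\<^sub>R b) ` (PiE (Basis :: 'a set) (\<lambda>_. UNIV :: int set))"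
      by (rule image_eqI[where x = "restrict (\<lambda>b. \<lfloor>m \<bullet> b\<rfloor>) Basis"]) auto
  qed
  show "countable ((\<lambda>g. \<Sum>b\<in>Basis. of_int (g b) *\<^sub>R b) ` (PiE (Basis :: 'a set) (\<lambda>_. UNIV :: int set)))"
    by (intro countable_image countable_PiE) auto
qed

lemma dyadic_level_partition:
  fixes \<beta> :: "int \<Rightarrow> 'a::euclidean_space"
  shows "countable (dyadic_level \<beta> k)" "disjoint (dyadic_level \<beta> k)" "\<Union>(dyadic_level \<beta> k) = UNIV"
    and "\<And>Q. Q \<in> dyadic_level \<beta> k \<Longrightarrow> Q \<in> sets lebesgue"
proof -
  show "disjoint (dyadic_level \<beta> k)"
    unfolding disjoint_def dyadic_level_eq using dyadic_cube_unique[of _ _ _ \<beta> k] by blast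
  show "\<Union>(dyadic_level \<beta> k) = UNIV"
    using dyadic_cube_cover[of _ \<beta> k] by (auto simp: dyadic_level_eq)
qed (auto simp: dyadic_level_eq countable_integer_points intro: fmeasurableD dyadic_cube_measure(1))

section \<open>Children of a dyadic cube and the tree below it\<close>

definition binary_points :: "'a::euclidean_space set" where
  "binary_points = {d. \<forall>b\<in>Basis. d \<bullet> b \<in> {0, 1}}"

text \<open>A binary point corresponds to the set of basis vectors along which it is 1. The
  cardinality is the branching number of the dyadic tree.\<close>

lemma finite_card_binary_points:
  "finite (binary_points :: 'a::euclidean_space set)" "card (binary_points :: 'a set) = 2 ^ DIM('a)"
proof -
  have inner: "(\<Sum>b\<in>S. b) \<bullet> b' = (if b' \<in> S then 1 else 0)" if "S \<subseteq> Basis" "b' \<in> Basis" for S and b' :: 'a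
  proof -
    have "(\<Sum>b\<in>S. b) \<bullet> b' = (\<Sum>b\<in>S. if b = b' then 1 else 0)"
      unfolding inner_sum_left using that by (intro sum.cong) (auto simp: inner_Basis)
    also have "\<dots> = (if b' \<in> S then 1 else 0)"
      using finite_subset[OF that(1) finite_Basis] by simp
    finally show ?thesis .
  qed
  have "bij_betw (\<lambda>S. \<Sum>b\<in>S. b) (Pow Basis) (binary_points :: 'a set)"
  proof (rule bij_betw_byWitness[where f' = "\<lambda>d. {b \<in> Basis. d \<bullet> b = 1}"])
    show "\<forall>S\<in>Pow Basis. {b \<in> Basis. (\<Sum>b\<in>S. b) \<bullet> b = 1} = (S :: 'a set)"
    proof
      fix S :: "'a set" assume "S \<in> Pow Basis"
      then have S: "S \<subseteq> Basis" by simp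
      then have "b \<in> Basis \<Longrightarrow> (\<Sum>b\<in>S. b) \<bullet> b = 1 \<longleftrightarrow> b \<in> S" for b by (simp add: inner)
      with S show "{b \<in> Basis. (\<Sum>b\<in>S. b) \<bullet> b = 1} = S" by blast
    qed
    show "\<forall>d\<in>(binary_points :: 'a set). (\<Sum>b\<in>{b \<in> Basis. d \<bullet> b = 1}. b) = d"
    proof (rule ballI, rule euclidean_eqI)
      fix d b :: 'a assume d: "d \<in> binary_points" and b: "b \<in> Basis"
      have "(\<Sum>b\<in>{b \<in> Basis. d \<bullet> b = 1}. b) \<bullet> b = (if b \<in> {b \<in> Basis. d \<bullet> b = 1} then 1 else 0)"
        by (rule inner) (use b in auto)
      moreover have "d \<bullet> b \<in> {0, 1}" using d b by (simp add: binary_points_def)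
      ultimately show "(\<Sum>b\<in>{b \<in> Basis. d \<bullet> b = 1}. b) \<bullet> b = d \<bullet> b" using b by auto
    qed
    show "(\<lambda>S. \<Sum>b\<in>S. b) ` Pow Basis \<subseteq> (binary_points :: 'a set)"
    proof (intro image_subsetI)
      fix S :: "'a set" assume "S \<in> Pow Basis"
      then show "(\<Sum>b\<in>S. b) \<in> binary_points" by (simp add: binary_points_def inner)
    qed
  qed auto
  from bij_betw_finite[OF this] bij_betw_same_card[OF this]
  show "finite (binary_points :: 'a set)" "card (binary_points :: 'a set) = 2 ^ DIM('a)"
    by (simp_all add: card_Pow)
qed

lemma dyadic_coord_Suc:
  assumes "dyadic_parameter \<beta>"
  shows "dyadic_coord \<beta> (k + 1) x = 2 *\<^sub>R dyadic_coord \<beta> k x + \<beta> (k + 1)"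
proof -
  have "(2::real) powi (k + 1) * 2 powi (-(k + 1)) = 1" by (simp flip: power_int_add)
  then show ?thesis
    unfolding dyadic_coord_def dyadic_shift_rec[OF assms, of k]
    by (simp add: power_int_add algebra_simps)
qed

text \<open>In coordinates, the next level is reached by doubling and adding the integer vector
  \<open>\<beta> (k + 1)\<close>. A unit cell becomes a cell of side 2 with integer corners, a union
  of unit cells; hence the levels are nested for every choice of digits.\<close>

lemma dyadic_cube_children:
  assumes "dyadic_parameter \<beta>"
  shows "dyadic_cube \<beta> k m = (\<Union>d\<in>binary_points. dyadic_cube \<beta> (k + 1) (2 *\<^sub>R m + \<beta> (k + 1) + d))"
proof (intro subset_antisym subsetI)
  fix x assume x: "x \<in> dyadic_cube \<beta> k m"
  let ?y = "dyadic_coord \<beta> k x"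
  \<comment> \<open>\<open>d\<close> records, coordinate by coordinate, which half of the cube
    contains \<open>x\<close>.\<close>
  define d where "d = (\<Sum>b\<in>Basis. (if m \<bullet> b + 1 / 2 \<le> ?y \<bullet> b then 1 else 0) *\<^sub>R b)"
  have d: "d \<bullet> b = (if m \<bullet> b + 1 / 2 \<le> ?y \<bullet> b then 1 else 0)" if "b \<in> Basis" for b
    unfolding d_def using that by simp
  have "d \<in> binary_points" by (simp add: binary_points_def d)
  moreover have "x \<in> dyadic_cube \<beta> (k + 1) (2 *\<^sub>R m + \<beta> (k + 1) + d)"
    unfolding mem_dyadic_cube dyadic_coord_Suc[OF assms]
  proof
    fix b :: 'a assume b: "b \<in> Basis"
    then have "m \<bullet> b \<le> ?y \<bullet> b" "?y \<bullet> b < m \<bullet> b + 1" using x by (auto simp: mem_dyadic_cube)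
    then show "(2 *\<^sub>R m + \<beta> (k + 1) + d) \<bullet> b \<le> (2 *\<^sub>R ?y + \<beta> (k + 1)) \<bullet> b \<and>
        (2 *\<^sub>R ?y + \<beta> (k + 1)) \<bullet> b < (2 *\<^sub>R m + \<beta> (k + 1) + d) \<bullet> b + 1"
      using d[OF b] by (auto simp: inner_add_left)
  qed
  ultimately show "x \<in> (\<Union>d\<in>binary_points. dyadic_cube \<beta> (k + 1) (2 *\<^sub>R m + \<beta> (k + 1) + d))" by blast
next
  fix x assume "x \<in> (\<Union>d\<in>binary_points. dyadic_cube \<beta> (k + 1) (2 *\<^sub>R m + \<beta> (k + 1) + d))"
  then obtain d where d: "d \<in> binary_points" "x \<in> dyadic_cube \<beta> (k + 1) (2 *\<^sub>R m + \<beta> (k + 1) + d)" by blast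
  let ?y = "dyadic_coord \<beta> k x"
  show "x \<in> dyadic_cube \<beta> k m"
    unfolding mem_dyadic_cube
  proof
    fix b :: 'a assume b: "b \<in> Basis"
    then have "d \<bullet> b = 0 \<or> d \<bullet> b = 1" using d(1) by (auto simp: binary_points_def)
    then show "m \<bullet> b \<le> ?y \<bullet> b \<and> ?y \<bullet> b < m \<bullet> b + 1"
      using d(2) b by (auto simp: mem_dyadic_cube dyadic_coord_Suc[OF assms] inner_add_left)
  qed
qed

text \<open>Path coding: the base-\<open>B\<close> digits of \<open>i\<close> choose the children on
  the way down from \<open>m\<close>, with \<open>i mod B\<close> the last choice and
  \<open>e\<close> enumerating the binary points. At level 0 the index is ignored.\<close>

fun dyadic_node :: "(nat \<Rightarrow> 'a) \<Rightarrow> nat \<Rightarrow> (int \<Rightarrow> 'a::euclidean_space) \<Rightarrow> int \<Rightarrow> 'a \<Rightarrow> nat \<Rightarrow> nat \<Rightarrow> 'a" where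
  "dyadic_node e B \<beta> k m 0 i = m"
| "dyadic_node e B \<beta> k m (Suc j) i =
    2 *\<^sub>R dyadic_node e B \<beta> k m j (i div B) + \<beta> (k + int j + 1) + e (i mod B)"

text \<open>The nodes are the dyadic descendants of \<open>Q\<close>. That they exhaust the cubes of
  each finer level through points of \<open>Q\<close> serves the sufficiency of the tree bound; that
  they belong to the system serves its necessity.\<close>

lemma dyadic_tree:
  fixes \<beta> :: "int \<Rightarrow> 'a::euclidean_space"
  assumes \<beta>: "dyadic_parameter \<beta>" and Q: "Q \<in> dyadic_level \<beta> k"
  shows "\<exists>c V. set_tree (2 ^ DIM('a)) c V \<and> c 0 0 = Q \<and>
    (\<forall>j x. x \<in> Q \<longrightarrow> {R \<in> dyadic_level \<beta> (k + int j). x \<in> R} = {c j i | i. i < (2 ^ DIM('a)) ^ j \<and> x \<in> c j i}) \<and>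
    (\<forall>j i. c j i \<in> dyadic_level \<beta> (k + int j))"
proof -
  define B :: nat where "B = 2 ^ DIM('a)"
  obtain e where e: "bij_betw e {..<B} (binary_points :: 'a set)"
    using ex_bij_betw_nat_finite[OF finite_card_binary_points(1)]
    unfolding finite_card_binary_points(2) B_def by (auto simp: atLeast0LessThan)
  have B: "0 < B" by (simp add: B_def)
  obtain m where m: "m \<in> integer_points" "Q = dyadic_cube \<beta> k m" using Q by (auto simp: dyadic_level_eq)
  define \<nu> where "\<nu> = dyadic_node e B \<beta> k m"
  have e_int: "e l \<in> binary_points" if "l < B" for l using e that by (auto simp: bij_betw_def)
  have add_int: "2 *\<^sub>R u + \<beta> j + d \<in> integer_points" if "u \<in> integer_points" "d \<in> binary_points" for u d j
    unfolding integer_points_def mem_Collect_eq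
  proof
    fix b :: 'a assume b: "b \<in> Basis"
    have "u \<bullet> b \<in> \<int>" "\<beta> j \<bullet> b \<in> \<int>" "d \<bullet> b \<in> \<int>"
      using that \<beta> b unfolding integer_points_def binary_points_def dyadic_parameter_def
      by (auto, (metis Ints_0 Ints_1 insertE singletonD)+)
    then show "(2 *\<^sub>R u + \<beta> j + d) \<bullet> b \<in> \<int>"
      by (simp add: inner_add_left)
  qed
  have \<nu>_int: "\<nu> j i \<in> integer_points" for j i
  proof (induction j arbitrary: i)
    case (Suc j)
    show ?case unfolding \<nu>_def dyadic_node.simps unfolding \<nu>_def[symmetric]
      using B by (intro add_int Suc e_int) simp
  qed (simp add: \<nu>_def m)
  define c where "c j i = dyadic_cube \<beta> (k + int j) (\<nu> j i)" for j i
  have \<nu>_child: "\<nu> (Suc j) (B * i + l) = 2 *\<^sub>R \<nu> j i + \<beta> (k + int j + 1) + e l" if "l < B" for j i l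
    using that by (simp add: \<nu>_def)
  have c_child: "c (Suc j) (B * i + l) = dyadic_cube \<beta> (k + int j + 1) (2 *\<^sub>R \<nu> j i + \<beta> (k + int j + 1) + e l)"
    if "l < B" for j i l
    unfolding c_def \<nu>_child[OF that] by (simp add: ac_simps)
  have tree: "set_tree B c (\<lambda>j. (2 powi (-(k + int j))) ^ DIM('a))"
  proof
    fix j i
    show "c j i = (\<Union>l<B. c (Suc j) (B * i + l))"
    proof -
      have "c j i = (\<Union>d\<in>e ` {..<B}. dyadic_cube \<beta> (k + int j + 1) (2 *\<^sub>R \<nu> j i + \<beta> (k + int j + 1) + d))"
        using e unfolding c_def by (subst dyadic_cube_children[OF \<beta>]) (simp add: bij_betw_def)
      also have "\<dots> = (\<Union>l<B. c (Suc j) (B * i + l))" by (simp add: c_child)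
      finally show ?thesis .
    qed
    show "disjoint_family_on (\<lambda>l. c (Suc j) (B * i + l)) {..<B}"
      unfolding disjoint_family_on_def
    proof (intro ballI impI)
      fix l l' assume l: "l \<in> {..<B}" "l' \<in> {..<B}" "l \<noteq> l'"
      then have "e l \<noteq> e l'" using e by (auto simp: bij_betw_def inj_on_def)
      then show "c (Suc j) (B * i + l) \<inter> c (Suc j) (B * i + l') = {}"
        using l dyadic_cube_unique[OF \<nu>_int[of "Suc j" "B * i + l"] \<nu>_int[of "Suc j" "B * i + l'"], of _ \<beta> "k + int (Suc j)"]
        unfolding c_def[of "Suc j"] by (auto simp: \<nu>_child)
    qed
  qed (use B in \<open>simp_all add: c_def dyadic_cube_measure\<close>)
  interpret set_tree B c "\<lambda>j. (2 powi (-(k + int j))) ^ DIM('a)" by (rule tree)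
  have root_Q: "c 0 0 = Q" by (simp add: c_def \<nu>_def m)
  have lev: "c j i \<in> dyadic_level \<beta> (k + int j)" for j i
    unfolding c_def dyadic_level_eq by (intro imageI \<nu>_int)
  have "{R \<in> dyadic_level \<beta> (k + int j). x \<in> R} = {c j i | i. i < B ^ j \<and> x \<in> c j i}" if x: "x \<in> Q" for j x
  proof (intro subset_antisym subsetI)
    fix R assume "R \<in> {R \<in> dyadic_level \<beta> (k + int j). x \<in> R}"
    then have R: "R \<in> dyadic_level \<beta> (k + int j)" "x \<in> R" by auto
    obtain i where i: "i < B ^ j" "x \<in> c j i" using x root[of j] unfolding root_Q by blast
    have "R = c j i"
      using disjointD[OF dyadic_level_partition(2) R(1) lev[of j i]] R(2) i(2) by blast
    then show "R \<in> {c j i | i. i < B ^ j \<and> x \<in> c j i}" using i by blast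
  qed (use lev in blast)
  then show ?thesis using tree root_Q lev unfolding B_def by blast
qed

subsection \<open>From trees to the maximal operators\<close>

text \<open>Integration against a density is a measure, so countable additivity splits both sides
  over \<open>P\<close>; the common \<open>C\<close> comes out of the sum.\<close>

lemma nn_integral_le_partition:
  assumes P: "countable P" "disjoint P" "\<Union>P = space M" "\<And>Q. Q \<in> P \<Longrightarrow> Q \<in> sets M"
    and [measurable]: "g \<in> borel_measurable M" "h \<in> borel_measurable M"
    and le: "\<And>Q. Q \<in> P \<Longrightarrow> (\<integral>\<^sup>+x. g x * indicator Q x \<partial>M) \<le> C * (\<integral>\<^sup>+x. h x * indicator Q x \<partial>M)"
  shows "(\<integral>\<^sup>+x. g x \<partial>M) \<le> C * (\<integral>\<^sup>+x. h x \<partial>M)"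
proof -
  have split: "(\<integral>\<^sup>+x. u x \<partial>M) = (\<integral>\<^sup>+Q. (\<integral>\<^sup>+x. u x * indicator Q x \<partial>M) \<partial>count_space P)"
    if [measurable]: "u \<in> borel_measurable M" for u
  proof -
    have "(\<integral>\<^sup>+x. u x \<partial>M) = (\<integral>\<^sup>+x. u x * indicator (space M) x \<partial>M)"
      by (rule nn_integral_cong) simp
    also have "\<dots> = emeasure (density M u) (space M)"
      by (simp add: emeasure_density)
    also have "\<dots> = emeasure (density M u) (\<Union>Q\<in>P. Q)" using P(3) by simp
    also have "\<dots> = (\<integral>\<^sup>+Q. emeasure (density M u) Q \<partial>count_space P)"
      using P(1,2,4) by (intro emeasure_UN_countable) (auto simp: disjoint_family_on_def disjoint_def)
    also have "\<dots> = (\<integral>\<^sup>+Q. (\<integral>\<^sup>+x. u x * indicator Q x \<partial>M) \<partial>count_space P)"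
      using P(4) by (intro nn_integral_cong) (simp add: emeasure_density)
    finally show ?thesis .
  qed
  have "(\<integral>\<^sup>+x. g x \<partial>M) \<le> (\<integral>\<^sup>+Q. C * (\<integral>\<^sup>+x. h x * indicator Q x \<partial>M) \<partial>count_space P)"
    by (subst split) (auto intro!: nn_integral_mono le)
  also have "\<dots> = C * (\<integral>\<^sup>+x. h x \<partial>M)" by (subst split[of h]) (auto simp: nn_integral_cmult)
  finally show ?thesis .
qed

text \<open>\<open>D' K\<close> are truncations of the family \<open>D\<close> to finitely many levels and \<open>P K\<close> is the coarsest of these
  levels. The truncated maximal functions are constant on small cubes, hence measurable.\<close>

lemma Lp_bounded_of_tree_bounded:
  fixes smul :: "'k::real_normed_field \<Rightarrow> 'x::banach \<Rightarrow> 'x" and \<Omega> :: "'a::euclidean_space set"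
  assumes p: "1 < p" and "tree_bounded smul p b"
    and \<Omega>: "\<Omega> \<in> sets lebesgue" and D: "D = (\<Union>K::nat. D' K)" "incseq D'"
    and P: "\<And>K. countable (P K)" "\<And>K. disjoint (P K)" "\<And>K. \<Union>(P K) = \<Omega>"
    and tree: "\<And>K Q. Q \<in> P K \<Longrightarrow> \<exists>c V N. set_tree b c V \<and> c 0 0 = Q \<and>
      (\<forall>x\<in>Q. {R \<in> D' K. x \<in> R} = {c j i | j i. j \<le> N \<and> i < b ^ j \<and> x \<in> c j i})"
  shows "Lp_bounded p (lebesgue_on \<Omega>) (rademacher_maximal smul D)"
proof -
  obtain C where C: "0 \<le> C" "\<And>N (f :: nat \<Rightarrow> 'x).
     (\<Sum>i<b ^ N. ennreal_powr (R_bound smul {block_mean (b ^ m) f (i div b ^ m) | m. m \<le> N}) p)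
       \<le> ennreal C * (\<Sum>i<b ^ N. ennreal (norm (f i) powr p))"
    using assms(2) unfolding tree_bounded_def by blast
  have p0: "0 < p" using p by simp
  let ?M = "lebesgue_on \<Omega>"
  have "(\<integral>\<^sup>+x. ennreal_powr (rademacher_maximal smul D f x) p \<partial>?M) \<le> ennreal C * (\<integral>\<^sup>+x. ennreal (norm (f x) powr p) \<partial>?M)"
    if "in_Lp p ?M f" for f
  proof -
    from that have f: "strongly_measurable ?M f" and fin: "(\<integral>\<^sup>+x. ennreal (norm (f x) powr p) \<partial>?M) < \<infinity>"
      by (auto simp: in_Lp_iff[OF p0])
    have [measurable]: "(\<lambda>x. norm (f x)) \<in> borel_measurable ?M"
      by (intro strongly_measurable_norm complete_measure_lebesgue_on \<Omega> f)
    define S where "S K x = {average f R | R. R \<in> D' K \<and> x \<in> R}" for K x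
    define g where "g K x = ennreal_powr (R_bound smul (S K x)) p" for K x
    have S: "incseq (\<lambda>K. S K x)" for x
      unfolding S_def incseq_def using D(2) by (auto simp: incseq_def)
    have "{average f Q | Q. Q \<in> D \<and> x \<in> Q} = (\<Union>K. S K x)" for x
      unfolding S_def D(1) by blast
    then have SUP: "ennreal_powr (rademacher_maximal smul D f x) p = (SUP K. g K x)" for x
      by (simp add: rademacher_maximal_def R_bound_UN_incseq[OF S] ennreal_powr_SUP[OF p0] g_def)
    have piece: "Q \<in> sets lebesgue \<and> g K \<in> borel_measurable (lebesgue_on Q) \<and>
        (\<integral>\<^sup>+x. g K x \<partial>lebesgue_on Q) \<le> ennreal C * (\<integral>\<^sup>+x. ennreal (norm (f x) powr p) \<partial>lebesgue_on Q)"
      if Q: "Q \<in> P K" for K Q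
    proof -
      from tree[OF Q] obtain c V N where cVN: "set_tree b c V \<and> c 0 0 = Q \<and>
          (\<forall>x\<in>Q. {R \<in> D' K. x \<in> R} = {c j i | j i. j \<le> N \<and> i < b ^ j \<and> x \<in> c j i})"
        by (elim exE) (rule that)
      then have c: "set_tree b c V" "c 0 0 = Q" by auto
      have D': "{R \<in> D' K. x \<in> R} = {c j i | j i. j \<le> N \<and> i < b ^ j \<and> x \<in> c j i}" if "x \<in> Q" for x
        using cVN that by (elim conjE) (rule bspec)
      interpret set_tree b c V by (rule c(1))
      have Qs: "Q \<in> sets lebesgue" "Q \<subseteq> \<Omega>" "c 0 0 \<in> lmeasurable"
        using sets_lebesgue[of 0 0] c(2) Q P(3) lmeasurable by auto
      note r = nn_integral_lebesgue_on_subset[OF \<Omega> Qs(1,2)]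
      have gK: "g K x = ennreal_powr (R_bound smul (local_averages f N x)) p" if "x \<in> Q" for x
      proof -
        have "S K x = average f ` {R \<in> D' K. x \<in> R}" unfolding S_def by blast
        also have "\<dots> = local_averages f N x" unfolding D'[OF that] local_averages_def by blast
        finally show ?thesis by (simp add: g_def)
      qed
      have fQ: "strongly_measurable (lebesgue_on (c 0 0)) f"
        using strongly_measurable_restrict_space[OF f sets_lebesgue_on_subset[OF \<Omega> Qs(1,2)]]
        by (simp add: lebesgue_on_restrict_space[OF \<Omega> Qs(1,2)] c(2))
      have "(\<integral>\<^sup>+x. ennreal (norm (f x) powr p) \<partial>lebesgue_on Q) \<le> (\<integral>\<^sup>+x. ennreal (norm (f x) powr p) \<partial>?M)"
        unfolding r by (intro nn_integral_mono) (auto split: split_indicator)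
      then have finQ: "(\<integral>\<^sup>+x. ennreal (norm (f x) powr p) \<partial>lebesgue_on (c 0 0)) < \<infinity>"
        unfolding c(2) using fin by (rule le_less_trans)
      have "g K \<in> borel_measurable (lebesgue_on Q) \<longleftrightarrow>
          (\<lambda>x. ennreal_powr (R_bound smul (local_averages f N x)) p) \<in> borel_measurable (lebesgue_on Q)"
        by (rule measurable_cong) (simp add: gK)
      moreover have "(\<lambda>x. ennreal_powr (R_bound smul (local_averages f N x)) p) \<in> borel_measurable (lebesgue_on Q)"
        using local_maximal_integral(2)[OF fQ nn_integral_norm_less_top[OF Qs(3) p fQ finQ]] by (simp add: c(2))
      moreover have "(\<integral>\<^sup>+x. g K x \<partial>lebesgue_on Q) =
          (\<integral>\<^sup>+x. ennreal_powr (R_bound smul (local_averages f N x)) p \<partial>lebesgue_on Q)"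
        by (rule nn_integral_cong) (simp add: gK)
      ultimately show ?thesis
        using local_maximal_bound[OF p C(2) fQ finQ, of N] Qs(1) by (simp add: c(2))
    qed
    have sub: "Q \<subseteq> \<Omega>" if "Q \<in> P K" for K Q using that P(3) by blast
    \<comment> \<open>Measurability is checked on the countably many cubes of the coarsest level; on
      each of them \<open>g K\<close> is constant on the finitely many leaves.\<close>
    have g: "g K \<in> borel_measurable ?M" for K
    proof (rule measurable_piecewise_restrict[OF P(1)[of K]])
      show "space ?M \<subseteq> \<Union>(P K)" by (simp add: P(3))
      fix Q assume Q: "Q \<in> P K"
      then show "Q \<inter> space ?M \<in> sets ?M" "g K \<in> borel_measurable (restrict_space ?M Q)"
        using piece[OF Q] sub[OF Q] sets_lebesgue_on_subset[OF \<Omega> _ sub[OF Q]]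
        by (simp_all add: lebesgue_on_restrict_space[OF \<Omega>] Int_absorb2)
    qed
    have "(\<integral>\<^sup>+x. g K x \<partial>?M) \<le> ennreal C * (\<integral>\<^sup>+x. ennreal (norm (f x) powr p) \<partial>?M)" for K
    proof (rule nn_integral_le_partition[OF P(1)[of K] P(2)])
      show "\<Union>(P K) = space ?M" by (simp add: P(3))
      show "Q \<in> sets ?M" if "Q \<in> P K" for Q
        using piece[OF that] sub[OF that] by (intro sets_lebesgue_on_subset \<Omega>) auto
      show "(\<integral>\<^sup>+x. g K x * indicator Q x \<partial>?M) \<le> ennreal C * (\<integral>\<^sup>+x. ennreal (norm (f x) powr p) * indicator Q x \<partial>?M)"
        if "Q \<in> P K" for Q
        using piece[OF that] nn_integral_lebesgue_on_subset[OF \<Omega> _ sub[OF that]] by simp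
    qed (use g in measurable)
    moreover have "(\<integral>\<^sup>+x. (SUP K. g K x) \<partial>?M) = (SUP K. \<integral>\<^sup>+x. g K x \<partial>?M)"
    proof (rule nn_integral_monotone_convergence_SUP[OF _ g])
      show "incseq g"
        unfolding incseq_def le_fun_def g_def using S
        by (auto intro!: ennreal_powr_mono[OF p0] R_bound_mono simp: incseq_def)
    qed
    ultimately show ?thesis unfolding SUP by (auto intro: SUP_least)
  qed
  then show ?thesis unfolding Lp_bounded_iff[OF p0] using C(1) by blast
qed

text \<open>For necessity, any one cube with its descendants will do. For sufficiency, the levels
  from \<open>- K\<close> to \<open>K\<close> form trees of depth \<open>2 * K\<close> rooted at the
  cubes of level \<open>- K\<close>; letting \<open>K\<close> grow removes the coarse and the fine
  cut-off together.\<close>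

lemma Lp_bounded_dyadic_system_iff:
  fixes \<beta> :: "int \<Rightarrow> 'a::euclidean_space" and smul :: "'k::real_normed_field \<Rightarrow> 'x::banach \<Rightarrow> 'x"
  assumes "1 < p" "dyadic_parameter \<beta>"
  shows "Lp_bounded p lebesgue (rademacher_maximal smul (dyadic_system \<beta>)) \<longleftrightarrow> tree_bounded smul p (2 ^ DIM('a))"
proof
  assume L: "Lp_bounded p lebesgue (rademacher_maximal smul (dyadic_system \<beta>))"
  obtain Q where "Q \<in> dyadic_level \<beta> 0" using dyadic_level_partition(3)[of \<beta> 0] by blast
  from dyadic_tree[OF assms(2) this] obtain c V where c: "set_tree (2 ^ DIM('a)) c V"
    "\<And>j i. c j i \<in> dyadic_level \<beta> (0 + int j)" by blast
  show "tree_bounded smul p (2 ^ DIM('a))"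
  proof (rule set_tree.tree_bounded_of_Lp_bounded[OF c(1) assms(1), of UNIV])
    show "c j i \<in> dyadic_system \<beta>" for j i using c(2)[of j i] by (auto simp: dyadic_system_def)
    show "Lp_bounded p (lebesgue_on UNIV) (rademacher_maximal smul (dyadic_system \<beta>))"
      using L by (simp add: lebesgue_on_UNIV_eq)
  qed auto
next
  assume T: "tree_bounded smul p (2 ^ DIM('a))"
  \<comment> \<open>Counting from the coarsest level matches the tree levels; the description by
    \<open>{- int K..int K}\<close>, derived next, is the one that visibly increases with
    \<open>K\<close>.\<close>
  define D where "D K = (\<Union>j\<le>2 * K. dyadic_level \<beta> (- int K + int j))" for K
  have D: "D K = (\<Union>k\<in>{- int K..int K}. dyadic_level \<beta> k)" for K
  proof (intro subset_antisym subsetI)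
    fix R assume "R \<in> (\<Union>k\<in>{- int K..int K}. dyadic_level \<beta> k)"
    then obtain k where "k \<in> {- int K..int K}" "R \<in> dyadic_level \<beta> k" by blast
    then show "R \<in> D K" unfolding D_def by (intro UN_I[of "nat (k + int K)"]) auto
  qed (force simp: D_def)
  have "Lp_bounded p (lebesgue_on UNIV) (rademacher_maximal smul (dyadic_system \<beta>))"
  proof (rule Lp_bounded_of_tree_bounded[OF assms(1) T])
    show "dyadic_system \<beta> = (\<Union>K. D K)"
    proof (intro subset_antisym subsetI)
      fix R assume "R \<in> dyadic_system \<beta>"
      then obtain k where "R \<in> dyadic_level \<beta> k" by (auto simp: dyadic_system_def)
      then have "R \<in> D (nat \<bar>k\<bar>)" unfolding D by (intro UN_I[of k]) auto
      then show "R \<in> (\<Union>K. D K)" by blast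
    qed (auto simp: dyadic_system_def D)
    show "incseq D" unfolding incseq_def D by (intro allI impI UN_mono) auto
    fix K :: nat
    show "countable (dyadic_level \<beta> (- int K))" "disjoint (dyadic_level \<beta> (- int K))" "\<Union>(dyadic_level \<beta> (- int K)) = UNIV"
      by (rule dyadic_level_partition)+
    fix Q assume "Q \<in> dyadic_level \<beta> (- int K)"
    from dyadic_tree[OF assms(2) this] obtain c V where c: "set_tree (2 ^ DIM('a)) c V" "c 0 0 = Q"
      "\<And>j x. x \<in> Q \<Longrightarrow> {R \<in> dyadic_level \<beta> (- int K + int j). x \<in> R} = {c j i | i. i < (2 ^ DIM('a)) ^ j \<and> x \<in> c j i}"
      by blast
    have "{R \<in> D K. x \<in> R} = {c j i | j i. j \<le> 2 * K \<and> i < (2 ^ DIM('a)) ^ j \<and> x \<in> c j i}" if "x \<in> Q" for x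
    proof -
      have "{R \<in> D K. x \<in> R} = (\<Union>j\<le>2 * K. {R \<in> dyadic_level \<beta> (- int K + int j). x \<in> R})"
        unfolding D_def by blast
      then show ?thesis unfolding c(3)[OF that] by blast
    qed
    then show "\<exists>c V N. set_tree (2 ^ DIM('a)) c V \<and> c 0 0 = Q \<and>
        (\<forall>x\<in>Q. {R \<in> D K. x \<in> R} = {c j i | j i. j \<le> N \<and> i < (2 ^ DIM('a)) ^ j \<and> x \<in> c j i})"
      using c(1,2) by blast
  qed simp
  then show "Lp_bounded p lebesgue (rademacher_maximal smul (dyadic_system \<beta>))"
    by (simp add: lebesgue_on_UNIV_eq)
qed

lemma unit_interval_in_dyadic_level: "{0..<1::real} \<in> dyadic_level (\<lambda>_. 0) 0"
proof -
  have "dyadic_cube (\<lambda>_. 0) 0 0 = {0..<1::real}"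
    by (auto simp: dyadic_cube_def dyadic_shift_def half_open_unit_cube_def image_iff)
  moreover have "(0::real) \<in> integer_points" by (simp add: integer_points_def)
  ultimately show ?thesis unfolding dyadic_level_eq by (metis image_eqI)
qed

text \<open>The interval is itself a standard cube of level 0, so only the fine scales are cut off:
  the tree rooted at it serves every truncation, and the partition has one element.\<close>

lemma Lp_bounded_unit_interval_iff:
  fixes smul :: "'k::real_normed_field \<Rightarrow> 'x::banach \<Rightarrow> 'x"
  assumes "1 < p"
  shows "Lp_bounded p (lebesgue_on {0..<1}) (rademacher_maximal smul unit_interval_dyadics) \<longleftrightarrow> tree_bounded smul p 2"
proof -
  let ?I = "{0..<1::real}"
  have "dyadic_parameter (\<lambda>_. 0 :: real)" by (simp add: dyadic_parameter_def)
  from dyadic_tree[OF this unit_interval_in_dyadic_level] obtain c V where c: "set_tree 2 c V" "c 0 0 = ?I"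
    "\<And>j x. x \<in> ?I \<Longrightarrow> {R \<in> dyadic_level (\<lambda>_. 0) (int j). x \<in> R} = {c j i | i. i < 2 ^ j \<and> x \<in> c j i}"
    "\<And>j i. c j i \<in> dyadic_level (\<lambda>_. 0) (int j)"
    by auto
  interpret set_tree 2 c V by (rule c(1))
  have I: "?I \<in> sets lebesgue" using sets_lebesgue[of 0 0] c(2) by simp
  show ?thesis
  proof
    assume L: "Lp_bounded p (lebesgue_on ?I) (rademacher_maximal smul unit_interval_dyadics)"
    show "tree_bounded smul p 2"
    proof (rule tree_bounded_of_Lp_bounded[OF assms I _ _ L])
      show "c j i \<in> unit_interval_dyadics" if "i < 2 ^ j" for j i
        unfolding unit_interval_dyadics_def using subset_root[OF that] c(2) c(4)[of j i]
        by (auto intro!: exI[of _ "int j"])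
    qed (simp add: c(2))
  next
    assume T: "tree_bounded smul p 2"
    define D where "D K = {R. R \<subseteq> ?I \<and> (\<exists>j\<le>K. R \<in> dyadic_level (\<lambda>_. 0) (int j))}" for K
    show "Lp_bounded p (lebesgue_on ?I) (rademacher_maximal smul unit_interval_dyadics)"
    proof (rule Lp_bounded_of_tree_bounded[OF assms T I])
      show "unit_interval_dyadics = (\<Union>K. D K)"
      proof (intro subset_antisym subsetI)
        fix R assume "R \<in> unit_interval_dyadics"
        then obtain k where k: "0 \<le> k" "R \<in> dyadic_level (\<lambda>_. 0) k" "R \<subseteq> ?I"
          by (auto simp: unit_interval_dyadics_def)
        then have "R \<in> D (nat k)" by (auto simp: D_def intro!: exI[of _ "nat k"])
        then show "R \<in> (\<Union>K. D K)" by blast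
      next
        fix R assume "R \<in> (\<Union>K. D K)"
        then obtain j where "R \<in> dyadic_level (\<lambda>_. 0) (int j)" "R \<subseteq> ?I" by (auto simp: D_def)
        then show "R \<in> unit_interval_dyadics" by (auto simp: unit_interval_dyadics_def intro!: exI[of _ "int j"])
      qed
      show "incseq D" by (rule incseq_SucI) (auto simp: D_def intro: le_SucI)
      fix K :: nat and Q assume "Q \<in> {?I}"
      have "{R \<in> D K. x \<in> R} = {c j i | j i. j \<le> K \<and> i < 2 ^ j \<and> x \<in> c j i}" if x: "x \<in> ?I" for x
      proof -
        have "{R \<in> D K. x \<in> R} = (\<Union>j\<le>K. {R \<in> {R \<in> dyadic_level (\<lambda>_. 0) (int j). x \<in> R}. R \<subseteq> ?I})"
          unfolding D_def by blast
        \<comment> \<open>A cube of level \<open>j \<ge> 0\<close> through a point of the interval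
          is a node and therefore lies in the root; this is how the inclusion in \<open>?I\<close>
          is met.\<close>
        also have "\<dots> = {c j i | j i. j \<le> K \<and> i < 2 ^ j \<and> x \<in> c j i}"
          unfolding c(3)[OF x] using subset_root unfolding c(2) by auto
        finally show ?thesis .
      qed
      then show "\<exists>c V N. set_tree 2 c V \<and> c 0 0 = Q \<and>
          (\<forall>x\<in>Q. {R \<in> D K. x \<in> R} = {c j i | j i. j \<le> N \<and> i < 2 ^ j \<and> x \<in> c j i})"
        using c(2) \<open>Q \<in> {?I}\<close> by (intro exI[of _ c] exI[of _ V] exI[of _ K] conjI ballI c(1)) simp_all
    qed auto
  qed
qed

theorem theorem4:
  fixes smul :: "'k::real_normed_field \<Rightarrow> 'x::banach \<Rightarrow> 'x"
    and \<beta> :: "int \<Rightarrow> real ^ 'n"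
    and \<beta>' :: "int \<Rightarrow> real"
    and p :: real
  assumes "banach_over smul"
    and "1 < p"
    and "dyadic_parameter \<beta>"
    and "dyadic_parameter \<beta>'"
  shows
    "(Lp_bounded p (lebesgue :: (real ^ 'n) measure) (rademacher_maximal smul (dyadic_system \<beta>)) \<longleftrightarrow>
      Lp_bounded p (lebesgue :: real measure) (rademacher_maximal smul (dyadic_system \<beta>'))) \<and>
     (Lp_bounded p (lebesgue :: real measure) (rademacher_maximal smul (dyadic_system \<beta>')) \<longleftrightarrow>
      Lp_bounded p (lebesgue_on {0..<1} :: real measure) (rademacher_maximal smul unit_interval_dyadics))"
proof -
  \<comment> \<open>The binary tree is thinned out by \<open>n = DIM(real ^ 'n)\<close>. On the real
    line the dimension is 1, so its tree is already binary.\<close>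
  have "tree_bounded smul p (2 ^ DIM(real ^ 'n)) \<longleftrightarrow> tree_bounded smul p 2"
    by (rule banach_over.tree_bounded_power[OF assms(1,2)]) auto
  then show ?thesis
    using assms by (simp add: Lp_bounded_dyadic_system_iff Lp_bounded_unit_interval_iff)
qed

end
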